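(* Let $k\ge 2$ be an even integer and let $G=K_{3\star(k/2+1),\,1\star(k/2-1)}$. (1) If $k\ge 4$, then a $k$-list assignment $L$ of $G$ is bad if and only if both of the following hold: (i) $\left|\bigcup_{v\in V(G)}L(v)\right|=\frac{3}{2}k$; (ii) for each partite set $P$ of $G$ with $|P|=3$, $\bigcap_{v\in P}L(v)=\emptyset$. (2) If $k=2$ (so $G=K_{3,3}$), then a $2$-list assignment $L$ of $K_{3,3}$ is bad if and only if it is isomorphic to a list assignment of the following form: the partite sets are $\{u_1,v_1,w_1\}$ and $\{u_2,v_2,w_2\}$, and $$L(u_1)=\{1,a\},\quad L(v_1)=\{1,b\},\quad L(w_1)=\{c,d\},$$ $$L(u_2)=\{1,c\},\quad L(v_2)=\{1,d\},\quad L(w_2)=\{a,b\},$$ where $a,b,c,d$ are colours different from $1$ with $a\ne b$ and $c\ne d$ (up to isomorphism there are three such list assignments, according to whether $|\{a,b\}\cap\{c,d\}|$ equals $0$, $1$ or $2$).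
   Context: $K_{3\star(k/2+1),\,1\star(k/2-1)}$ denotes the complete $k$-partite graph with $k/2+1$ partite sets of size $3$ and $k/2-1$ partite sets of size $1$; it has $2k+2$ vertices. A $k$-list assignment of a graph $G$ is a mapping $L$ which assigns to each vertex $v$ a set $L(v)$ of at least $k$ permissible colours, i.e. $|L(v)|\ge k$. An $L$-colouring of $G$ is a proper colouring of $G$ which colours each vertex $v$ with a colour from $L(v)$; $G$ is $L$-colourable if an $L$-colouring exists. A bad list assignment of $G=K_{3\star(k/2+1),\,1\star(k/2-1)}$ is a $k$-list assignment $L$ of $G$ such that $G$ is not $L$-colourable. Two list assignments of a graph are isomorphic if one is obtained from the other by an automorphism of the graph together with a bijective renaming of the colours. *)

theory Defs
  imports "HOL-Library.Multiset" "HOL-Library.Disjoint_Sets"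
begin

text \<open>A graph is given by its vertex set \<open>V\<close> and its adjacency relation \<open>E\<close>.\<close>

definition complete_multipartite ::
    "'v set \<Rightarrow> ('v \<Rightarrow> 'v \<Rightarrow> bool) \<Rightarrow> 'v set set \<Rightarrow> bool" where
  "complete_multipartite V E \<P> \<longleftrightarrow>
     finite V \<and> partition_on V \<P> \<and>
     (\<forall>u v. E u v \<longleftrightarrow> u \<in> V \<and> v \<in> V \<and> \<not> (\<exists>P\<in>\<P>. u \<in> P \<and> v \<in> P))"

text \<open>
  \<open>(V, E)\<close> is \<open>K\<close> with \<open>k/2 + 1\<close> partite sets of size 3 and \<open>k/2 - 1\<close> partite sets of size 1,
  and \<open>\<P>\<close> is its set of partite sets. Used only for even \<open>k \<ge> 2\<close>, so that the
  division is exact and the subtraction does not truncate.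
\<close>

definition is_K31 ::
    "nat \<Rightarrow> 'v set \<Rightarrow> ('v \<Rightarrow> 'v \<Rightarrow> bool) \<Rightarrow> 'v set set \<Rightarrow> bool" where
  "is_K31 k V E \<P> \<longleftrightarrow>
     complete_multipartite V E \<P> \<and>
     image_mset card (mset_set \<P>) =
       replicate_mset (k div 2 + 1) 3 + replicate_mset (k div 2 - 1) 1"

text \<open>Lists may be infinite; \<open>card\<close> is 0 on infinite sets, hence the extra disjunct.\<close>

definition k_list_assignment :: "nat \<Rightarrow> 'v set \<Rightarrow> ('v \<Rightarrow> 'c set) \<Rightarrow> bool" where
  "k_list_assignment k V L \<longleftrightarrow> (\<forall>v\<in>V. infinite (L v) \<or> k \<le> card (L v))"

definition proper_colouring ::
    "'v set \<Rightarrow> ('v \<Rightarrow> 'v \<Rightarrow> bool) \<Rightarrow> ('v \<Rightarrow> 'c) \<Rightarrow> bool" where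
  "proper_colouring V E f \<longleftrightarrow> (\<forall>u\<in>V. \<forall>v\<in>V. E u v \<longrightarrow> f u \<noteq> f v)"

definition list_colouring ::
    "'v set \<Rightarrow> ('v \<Rightarrow> 'v \<Rightarrow> bool) \<Rightarrow> ('v \<Rightarrow> 'c set) \<Rightarrow> ('v \<Rightarrow> 'c) \<Rightarrow> bool" where
  "list_colouring V E L f \<longleftrightarrow> proper_colouring V E f \<and> (\<forall>v\<in>V. f v \<in> L v)"

definition list_colourable ::
    "'v set \<Rightarrow> ('v \<Rightarrow> 'v \<Rightarrow> bool) \<Rightarrow> ('v \<Rightarrow> 'c set) \<Rightarrow> bool" where
  "list_colourable V E L \<longleftrightarrow> (\<exists>f. list_colouring V E L f)"

definition bad_list_assignment ::
    "nat \<Rightarrow> 'v set \<Rightarrow> ('v \<Rightarrow> 'v \<Rightarrow> bool) \<Rightarrow> ('v \<Rightarrow> 'c set) \<Rightarrow> bool" where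
  "bad_list_assignment k V E L \<longleftrightarrow> k_list_assignment k V L \<and> \<not> list_colourable V E L"

definition graph_automorphism ::
    "'v set \<Rightarrow> ('v \<Rightarrow> 'v \<Rightarrow> bool) \<Rightarrow> ('v \<Rightarrow> 'v) \<Rightarrow> bool" where
  "graph_automorphism V E \<phi> \<longleftrightarrow>
     bij_betw \<phi> V V \<and> (\<forall>u\<in>V. \<forall>v\<in>V. E (\<phi> u) (\<phi> v) \<longleftrightarrow> E u v)"

text \<open>
  The renaming \<open>\<pi>\<close> is a bijection between the colours occurring in the two assignments,
  which may be drawn from different colour types.
\<close>

definition list_isomorphic ::
    "'v set \<Rightarrow> ('v \<Rightarrow> 'v \<Rightarrow> bool) \<Rightarrow> ('v \<Rightarrow> 'c set) \<Rightarrow> ('v \<Rightarrow> 'd set) \<Rightarrow> bool" where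
  "list_isomorphic V E L L' \<longleftrightarrow>
     (\<exists>\<phi> \<pi>. graph_automorphism V E \<phi> \<and> bij_betw \<pi> (\<Union>v\<in>V. L v) (\<Union>v\<in>V. L' v) \<and>
            (\<forall>v\<in>V. L' (\<phi> v) = \<pi> ` L v))"

definition K33_form ::
    "'v set set \<Rightarrow> ('v \<Rightarrow> nat set) \<Rightarrow> nat \<Rightarrow> nat \<Rightarrow> nat \<Rightarrow> nat \<Rightarrow> bool" where
  "K33_form \<P> L a b c d \<longleftrightarrow>
     a \<noteq> 1 \<and> b \<noteq> 1 \<and> c \<noteq> 1 \<and> d \<noteq> 1 \<and> a \<noteq> b \<and> c \<noteq> d \<and>
     (\<exists>u1 v1 w1 u2 v2 w2.
        distinct [u1, v1, w1, u2, v2, w2] \<and> \<P> = {{u1, v1, w1}, {u2, v2, w2}} \<and>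
        L u1 = {1, a} \<and> L v1 = {1, b} \<and> L w1 = {c, d} \<and>
        L u2 = {1, c} \<and> L v2 = {1, d} \<and> L w2 = {a, b})"

end

theory Submission
  imports Defs
begin

text \<open>
  Write \<open>k = 2s\<close>: there are \<open>s + 1\<close> triples and \<open>s - 1\<close> singletons. For \<open>k \<ge> 4\<close> the two
  conditions force badness by counting. If no colour is common to a triple, a colouring spends two colours
  on every triple, hence at least \<open>2(s + 1) + (s - 1) = 3s + 1\<close> in total, one more than there are
  (\<open>card_colours_if_colourable\<close>).

  For the converse, colour a graph whose triples have no common colour by \<^emph>\<open>merging\<close>: choose some
  triples, identify two vertices in each of them, give the merged vertex the intersection of the
  two lists, and look for distinct representatives with Hall's theorem. The colours shared by a
  pair are absent from the list of the third vertex, so a set of vertices that contains a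
  merged pair together with its third vertex sees many colours. For which triples to merge, take
  the h-index of the sizes of the largest pairwise intersections: \<open>r\<close> triples having a pair with
  at least \<open>r\<close> shared colours, while every other triple has pairs with at most \<open>r\<close>. With \<open>p\<close>
  triples and \<open>q\<close> singletons this succeeds whenever \<open>r \<le> q\<close> or \<open>r = p\<close>
  (\<open>colourable_merging\<close>). So \<open>p \<le> q + 1\<close> is always fine, and a common colour of a
  triple can then be spent on it and the triple deleted: this is Ohba's theorem for such graphs
  (\<open>part_colourable_few_triples\<close>). Hence in a bad assignment with \<open>p = q + 2\<close> no triple has a
  common colour, because deleting that triple leaves \<open>p - 1 = q + 1\<close>.

  What remains is \<open>p = q + 2\<close> with \<open>r = q + 1 = s\<close>, where Hall's condition can only fail by
  one. Merging everything, or everything except one triple, shows which equalities this requires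
  (\<open>merge_all_tight\<close>, \<open>merge_all_but_one_tight\<close>). Playing the different choices of merged pairs
  against each other, with at least three triples available, shows that every triple
  uses exactly the same \<open>3s\<close> colours (\<open>card_colours_if_not_colourable\<close>). Infinite lists
  are reduced to finite ones by truncation.

  For \<open>k = 2\<close> there are only two triples. Colouring one of them blocks a colouring of the graph
  exactly if some list of the other triple is contained in the set of used colours. Merging shows
  that some two lists in one triple meet in a colour \<open>x\<close>; using \<open>x\<close> on both forces the lists
  of the other triple, and repeating the argument from there forces the rest. The pattern
  has five colour names, so its isomorphism type is given by the number of coincidences
  between \<open>{a, b}\<close> and \<open>{c, d}\<close>, which the total number of colours detects.
\<close>

section \<open>Systems of distinct representatives and h-indices\<close>

text \<open>Hall's theorem, by the argument of Halmos and Vaughan: either some proper nonempty subfamily is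
  tight, and it and the rest with its colours removed are represented separately, or there is
  slack everywhere, and one index may be represented arbitrarily.\<close>

lemma hall_marriage:
  fixes A :: "'i \<Rightarrow> 'c set"
  assumes "finite I" and "\<forall>i\<in>I. finite (A i)"
    and "\<forall>S\<subseteq>I. card S \<le> card (\<Union>i\<in>S. A i)"
  shows "\<exists>f. (\<forall>i\<in>I. f i \<in> A i) \<and> inj_on f I"
  using assms
proof (induction "card I" arbitrary: I A rule: less_induct)
  case less
  note fin = \<open>finite I\<close> and finA = less.prems(2) and hall = less.prems(3)
  have finU: "finite (\<Union>i\<in>S. A i)" if "S \<subseteq> I" for S
    using that fin finA by (auto intro: finite_subset)
  show ?case
  proof (cases "\<exists>S. S \<subset> I \<and> S \<noteq> {} \<and> card (\<Union>i\<in>S. A i) = card S")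
    case True
    then obtain S where S: "S \<subset> I" "S \<noteq> {}" and tight: "card (\<Union>i\<in>S. A i) = card S"
      by blast
    have finS: "finite S" using S fin finite_subset by blast
    have "card S < card I" using S fin psubset_card_mono by blast
    then obtain f where f: "\<forall>i\<in>S. f i \<in> A i" "inj_on f S"
      using less.hyps[of S A] finS S finA hall by (metis psubset_imp_subset subset_trans subsetD)
    define W where "W = (\<Union>i\<in>S. A i)"
    have "card (I - S) < card I"
      using S fin by (intro psubset_card_mono) auto
    moreover have "card S' \<le> card (\<Union>i\<in>S'. A i - W)" if S': "S' \<subseteq> I - S" for S'
    proof -
      have "card S' + card S = card (S' \<union> S)"
        using S' finS fin by (subst card_Un_disjoint) (auto intro: finite_subset)
      also have "\<dots> \<le> card (\<Union>i\<in>S' \<union> S. A i)"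
        using hall S S' by (metis Diff_subset Un_subset_iff psubset_imp_subset subset_trans)
      also have "(\<Union>i\<in>S' \<union> S. A i) = (\<Union>i\<in>S'. A i - W) \<union> W"
        by (auto simp: W_def)
      also have "card \<dots> \<le> card (\<Union>i\<in>S'. A i - W) + card W"
        by (rule card_Un_le)
      finally show ?thesis using tight by (simp add: W_def)
    qed
    ultimately obtain g where g: "\<forall>i\<in>I - S. g i \<in> A i - W" "inj_on g (I - S)"
      using less.hyps[of "I - S" "\<lambda>i. A i - W"] fin finA by auto
    define h where "h i = (if i \<in> S then f i else g i)" for i
    have fW: "f i \<in> W" if "i \<in> S" for i using f that by (auto simp: W_def)
    have "inj_on h I"
    proof (rule inj_onI)
      fix i j assume "i \<in> I" "j \<in> I" "h i = h j"
      then show "i = j"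
        using f(2) g fW unfolding h_def inj_on_def by (metis Diff_iff)
    qed
    moreover have "\<forall>i\<in>I. h i \<in> A i" using f g by (auto simp: h_def)
    ultimately show ?thesis by blast
  next
    case False
    show ?thesis
    proof (cases "I = {}")
      case True
      then show ?thesis by auto
    next
      case nonempty: False
      then obtain x where x: "x \<in> I" by blast
      have "card {x} \<le> card (\<Union>i\<in>{x}. A i)" using hall x by blast
      then have "A x \<noteq> {}" by auto
      then obtain c where c: "c \<in> A x" by blast
      have "card S \<le> card (\<Union>i\<in>S. A i - {c})" if S: "S \<subseteq> I - {x}" for S
      proof (cases "S = {}")
        case False
        have "S \<subset> I" using S x by blast
        then have "card S < card (\<Union>i\<in>S. A i)"
          using \<open>\<not> (\<exists>S. _ S)\<close> False hall by (metis le_neq_implies_less psubset_imp_subset)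
        moreover have "(\<Union>i\<in>S. A i - {c}) = (\<Union>i\<in>S. A i) - {c}" by blast
        moreover have "finite (\<Union>i\<in>S. A i)" using finU \<open>S \<subset> I\<close> by blast
        ultimately show ?thesis by (auto simp: card_Diff_singleton_if)
      qed simp
      moreover have "card (I - {x}) < card I" by (rule card_Diff1_less[OF fin x])
      ultimately obtain g where g: "\<forall>i\<in>I - {x}. g i \<in> A i - {c}" "inj_on g (I - {x})"
        using less.hyps[of "I - {x}" "\<lambda>i. A i - {c}"] fin finA
        by (metis (no_types, lifting) Diff_iff finite_Diff)
      have "inj_on (g(x := c)) I"
        using g by (auto simp: inj_on_def)
      moreover have "\<forall>i\<in>I. (g(x := c)) i \<in> A i" using g c by auto
      ultimately show ?thesis by blast
    qed
  qed
qed

text \<open>The largest \<open>r\<close> such that at least \<open>r\<close> elements have value at least \<open>r\<close>; the elements of value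
  more than \<open>r\<close> number at most \<open>r\<close>, and \<open>M\<close> pads them to exactly \<open>r\<close>.\<close>

lemma h_index:
  fixes m :: "'a \<Rightarrow> nat"
  assumes "finite T"
  shows "\<exists>M\<subseteq>T. (\<forall>x\<in>M. card M \<le> m x) \<and> (\<forall>x\<in>T - M. m x \<le> card M)"
proof -
  define ok where "ok r \<longleftrightarrow> r \<le> card {x\<in>T. r \<le> m x}" for r
  have bound: "r \<le> card T" if "ok r" for r
    using that assms card_mono[of T "{x\<in>T. r \<le> m x}"] by (auto simp: ok_def)
  have "ok 0" by (simp add: ok_def)
  then obtain r where r: "ok r" and max: "\<And>r'. ok r' \<Longrightarrow> r' \<le> r"
    using Greatest_le_nat[of ok _ "card T"] GreatestI_nat[of ok 0 "card T"] bound by blast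
  have "card {x\<in>T. Suc r \<le> m x} \<le> r"
    using max[of "Suc r"] by (force simp: ok_def)
  moreover have "{x\<in>T. Suc r \<le> m x} \<subseteq> {x\<in>T. r \<le> m x}" by auto
  ultimately have "\<exists>M. {x\<in>T. Suc r \<le> m x} \<subseteq> M \<and> M \<subseteq> {x\<in>T. r \<le> m x} \<and> card M = r"
    using r assms by (intro exists_subset_between) (auto simp: ok_def)
  then obtain M where M: "{x\<in>T. Suc r \<le> m x} \<subseteq> M" "M \<subseteq> {x\<in>T. r \<le> m x}" "card M = r"
    by blast
  have "m x \<le> r" if "x \<in> T - M" for x
  proof (rule ccontr)
    assume "\<not> m x \<le> r"
    then have "x \<in> {x\<in>T. Suc r \<le> m x}" using that by simp
    then show False using M that by blast
  qed
  then show ?thesis using M by (intro exI[of _ M]) auto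
qed

section \<open>Colouring disjoint triples and singletons\<close>

text \<open>The partite sets of a complete multipartite graph whose parts have sizes 3 and 1: the triples
  are collected in \<open>T\<close>, while the singletons are represented by the set \<open>Q\<close> of their elements.\<close>

definition triple_system :: "'v set \<Rightarrow> 'v set set \<Rightarrow> bool" where
  "triple_system Q T \<longleftrightarrow>
     finite Q \<and> finite T \<and> disjoint T \<and> Q \<inter> \<Union>T = {} \<and> (\<forall>P\<in>T. card P = 3)"

definition part_colourable :: "'v set \<Rightarrow> 'v set set \<Rightarrow> ('v \<Rightarrow> 'c set) \<Rightarrow> bool" where
  "part_colourable Q T L \<longleftrightarrow>
     (\<exists>f. (\<forall>x\<in>Q \<union> \<Union>T. f x \<in> L x) \<and>
          (\<forall>x\<in>Q \<union> \<Union>T. \<forall>y\<in>Q \<union> \<Union>T. f x = f y \<longrightarrow> x = y \<or> (\<exists>P\<in>T. x \<in> P \<and> y \<in> P)))"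

text \<open>A colouring may be given blockwise: blocks are subsets of parts, each with a colour common to
  all its lists, and distinct blocks get distinct colours.\<close>

lemma part_colourable_blocks:
  assumes "finite \<B>" and cover: "Q \<union> \<Union>T \<subseteq> \<Union>\<B>"
    and small: "\<forall>B\<in>\<B>. (\<exists>x. B = {x}) \<or> (\<exists>P\<in>T. B \<subseteq> P)"
    and fin: "\<forall>B\<in>\<B>. finite (\<Inter>x\<in>B. L x)"
    and hall: "\<forall>S\<subseteq>\<B>. card S \<le> card (\<Union>B\<in>S. \<Inter>x\<in>B. L x)"
  shows "part_colourable Q T L"
proof -
  obtain g where g: "\<forall>B\<in>\<B>. g B \<in> (\<Inter>x\<in>B. L x)" "inj_on g \<B>"
    using hall_marriage[OF \<open>finite \<B>\<close> fin hall] by blast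
  have "\<exists>\<beta>. \<forall>x\<in>Q \<union> \<Union>T. \<beta> x \<in> \<B> \<and> x \<in> \<beta> x"
    using cover by (intro bchoice) blast
  then obtain \<beta> where \<beta>: "\<forall>x\<in>Q \<union> \<Union>T. \<beta> x \<in> \<B> \<and> x \<in> \<beta> x" by blast
  have "g (\<beta> x) \<in> L x" if "x \<in> Q \<union> \<Union>T" for x
    using g(1) \<beta> that by blast
  moreover have "x = y \<or> (\<exists>P\<in>T. x \<in> P \<and> y \<in> P)"
    if "x \<in> Q \<union> \<Union>T" "y \<in> Q \<union> \<Union>T" "g (\<beta> x) = g (\<beta> y)" for x y
  proof -
    have "\<beta> x = \<beta> y" using g(2) \<beta> that by (meson inj_onD)
    then have "x \<in> \<beta> x" "y \<in> \<beta> x" "\<beta> x \<in> \<B>" using \<beta> that by metis+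
    then show ?thesis using small by (metis singletonD subsetD)
  qed
  ultimately show ?thesis
    unfolding part_colourable_def by (intro exI[of _ "\<lambda>x. g (\<beta> x)"]) blast
qed

lemma part_colourable_mono:
  assumes "part_colourable Q T L'" "\<forall>x\<in>Q \<union> \<Union>T. L' x \<subseteq> L x"
  shows "part_colourable Q T L"
proof -
  obtain f where f: "\<forall>x\<in>Q \<union> \<Union>T. f x \<in> L' x"
    "\<forall>x\<in>Q \<union> \<Union>T. \<forall>y\<in>Q \<union> \<Union>T. f x = f y \<longrightarrow> x = y \<or> (\<exists>P\<in>T. x \<in> P \<and> y \<in> P)"
    using assms(1) unfolding part_colourable_def by blast
  have "\<forall>x\<in>Q \<union> \<Union>T. f x \<in> L x" using f(1) assms(2) by blast
  then show ?thesis unfolding part_colourable_def using f(2) by (intro exI conjI)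
qed

lemma part_colourable_add_triple:
  assumes "part_colourable Q (T - {P}) (\<lambda>y. L y - {c})" "\<forall>x\<in>P. c \<in> L x" "P \<in> T"
    and "P \<inter> Q = {}" "disjoint T"
  shows "part_colourable Q T L"
proof -
  define V where "V = Q \<union> \<Union>(T - {P})"
  obtain f where f: "\<forall>y\<in>V. f y \<in> L y - {c}"
    "\<forall>y\<in>V. \<forall>z\<in>V. f y = f z \<longrightarrow> y = z \<or> (\<exists>P'\<in>T - {P}. y \<in> P' \<and> z \<in> P')"
    using assms(1) unfolding part_colourable_def V_def by blast
  define g where "g x = (if x \<in> P then c else f x)" for x
  have V: "Q \<union> \<Union>T = V \<union> P" "V \<inter> P = {}"
    using assms(3-5) unfolding V_def disjoint_def by blast+
  show ?thesis
    unfolding part_colourable_def V(1)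
  proof (intro exI[of _ g] conjI ballI impI)
    fix y assume "y \<in> V \<union> P"
    then show "g y \<in> L y" using f(1) assms(2) by (auto simp: g_def)
  next
    fix y z assume yz: "y \<in> V \<union> P" "z \<in> V \<union> P" and eq: "g y = g z"
    have ne: "f y \<noteq> c" if "y \<in> V" for y using f(1) that by blast
    show "y = z \<or> (\<exists>P\<in>T. y \<in> P \<and> z \<in> P)"
    proof (cases "y \<in> P \<or> z \<in> P")
      case True
      then have "y \<in> P \<and> z \<in> P" using eq ne yz by (metis Un_iff g_def)
      then show ?thesis using assms(3) by blast
    next
      case False
      then have "f y = f z" "y \<in> V" "z \<in> V" using eq yz by (auto simp: g_def)
      then show ?thesis using f(2) by blast
    qed
  qed
qed

section \<open>Merging pairs inside triples without a common colour\<close>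

text \<open>All triples have empty common intersection; the list size is the number of parts.\<close>

locale spread_lists =
  fixes Q :: "'v set" and T :: "'v set set" and L :: "'v \<Rightarrow> 'c set"
  assumes system: "triple_system Q T"
    and lists: "\<And>x. x \<in> Q \<union> \<Union>T \<Longrightarrow> finite (L x) \<and> card Q + card T \<le> card (L x)"
    and spread: "\<And>P. P \<in> T \<Longrightarrow> (\<Inter>x\<in>P. L x) = {}"
begin

text \<open>For a triple \<open>P = {u, v, w}\<close> this is \<open>L u \<inter> L v\<close>. A pair inside a triple is named by the
  vertex that it omits.\<close>

definition shared :: "'v set \<Rightarrow> 'v \<Rightarrow> 'c set" where
  "shared P w = (\<Inter>x\<in>P - {w}. L x)"

text \<open>The part \<open>P\<close> after merging: the triples in \<open>M\<close> are split into a merged pair and the vertex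
  \<open>w P\<close>, all others into single vertices.\<close>

definition blocks :: "'v set set \<Rightarrow> ('v set \<Rightarrow> 'v) \<Rightarrow> 'v set \<Rightarrow> 'v set set" where
  "blocks M w P = (if P \<in> M then {P - {w P}, {w P}} else (\<lambda>x. {x}) ` P)"

definition merged :: "'v set set \<Rightarrow> ('v set \<Rightarrow> 'v) \<Rightarrow> 'v set set" where
  "merged M w = (\<lambda>x. {x}) ` Q \<union> (\<Union>P\<in>T. blocks M w P)"

abbreviation colours :: "'v set set \<Rightarrow> 'c set" where
  "colours S \<equiv> \<Union>B\<in>S. \<Inter>x\<in>B. L x"

lemma finQ: "finite Q" and finT: "finite T" and card_triple: "P \<in> T \<Longrightarrow> card P = 3"
  using system by (auto simp: triple_system_def)

lemma fin_triple: "P \<in> T \<Longrightarrow> finite P"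
  using card_triple[of P] by (intro card_ge_0_finite) simp

lemma triple_eq:
  assumes "P \<in> T" "w \<in> P"
  obtains u v where "P = {u, v, w}" "u \<noteq> v" "u \<noteq> w" "v \<noteq> w"
proof -
  have "card (P - {w}) = 2" using assms card_triple fin_triple by simp
  then obtain u v where "P - {w} = {u, v}" "u \<noteq> v" by (auto simp: card_2_iff)
  then show thesis using that[of u v] assms by blast
qed

lemma shared_eq: "u \<noteq> w \<Longrightarrow> v \<noteq> w \<Longrightarrow> shared {u, v, w} w = L u \<inter> L v"
  by (auto simp: shared_def)

lemma in_lists:
  assumes "P \<in> T" "x \<in> P" shows "finite (L x)" "card Q + card T \<le> card (L x)"
  using lists[of x] assms by auto

lemma finite_shared:
  assumes "P \<in> T" "w \<in> P"
  shows "finite (shared P w)"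
proof -
  obtain u v where "P = {u, v, w}" "u \<noteq> v" "u \<noteq> w" "v \<noteq> w" using triple_eq assms .
  then show ?thesis using in_lists[of P u] assms(1) by (simp add: shared_eq)
qed

lemma shared_disjoint: "P \<in> T \<Longrightarrow> w \<in> P \<Longrightarrow> shared P w \<inter> L w = {}"
  using spread[of P] by (auto simp: shared_def)

lemma shared_shared_disjoint:
  assumes "P \<in> T" "w \<in> P" "w' \<in> P" "w \<noteq> w'"
  shows "shared P w \<inter> shared P w' = {}"
proof -
  have "shared P w' \<subseteq> L w" using assms by (auto simp: shared_def)
  then show ?thesis using shared_disjoint assms by blast
qed

lemma card_kept:
  assumes "P \<in> T" "w \<in> P"
  shows "card (shared P w) + (card Q + card T) \<le> card (shared P w \<union> L w)"
  using assms in_lists[of P w] finite_shared[of P w] shared_disjoint[of P w]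
  by (simp add: card_Un_disjoint)

lemma card_two_lists:
  assumes "P = {u, v, w}" "P \<in> T" "u \<noteq> v" "u \<noteq> w" "v \<noteq> w"
  shows "2 * card Q + 2 * card T \<le> card (L u \<union> L v) + card (shared P w)"
proof -
  have "card (L u) + card (L v) = card (L u \<union> L v) + card (shared P w)"
    using assms in_lists[of P] card_Un_Int[of "L u" "L v"] by (simp add: shared_eq)
  then show ?thesis using in_lists[of P u] in_lists[of P v] assms by auto
qed

text \<open>Bonferroni's inequality for three lists.\<close>

lemma card_three_lists:
  assumes "P = {u, v, w}" "P \<in> T" "u \<noteq> v" "u \<noteq> w" "v \<noteq> w"
  shows "3 * card Q + 3 * card T
    \<le> card (L u \<union> L v \<union> L w) + card (shared P u) + card (shared P v) + card (shared P w)"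
proof -
  have fin: "finite (L u)" "finite (L v)" "finite (L w)" using in_lists[of P] assms by auto
  have sh: "shared P u = L v \<inter> L w" "shared P v = L u \<inter> L w"
    using assms(1,3-5) by (auto simp: shared_def)
  have "card (L u \<union> L v) + card (L w) = card (L u \<union> L v \<union> L w) + card ((L u \<union> L v) \<inter> L w)"
    using fin by (intro card_Un_Int) auto
  moreover have "card ((L u \<union> L v) \<inter> L w) \<le> card (shared P v) + card (shared P u)"
    unfolding sh Int_Un_distrib2 by (rule card_Un_le)
  ultimately show ?thesis
    using card_two_lists[OF assms] in_lists[of P w] assms by auto
qed

lemma merged_block:
  assumes "M \<subseteq> T" "\<forall>P\<in>M. w P \<in> P" "B \<in> merged M w"
  shows "(\<exists>x\<in>Q \<union> \<Union>T. B = {x}) \<or> (\<exists>P\<in>M. B = P - {w P})"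
proof -
  have "\<exists>x\<in>Q \<union> \<Union>T. B = {x}" if "P \<in> T" "B \<in> blocks M w P" "\<not> (P \<in> M \<and> B = P - {w P})" for P
    using that assms(2) by (auto simp: blocks_def split: if_splits)
  then show ?thesis using assms(3) unfolding merged_def by blast
qed

lemma finite_merged: "finite (merged M w)"
  using finQ finT fin_triple by (auto simp: merged_def blocks_def)

lemma finite_block:
  assumes "M \<subseteq> T" "\<forall>P\<in>M. w P \<in> P" "B \<in> merged M w"
  shows "finite (\<Inter>x\<in>B. L x)"
  using merged_block[OF assms]
proof
  assume "\<exists>P\<in>M. B = P - {w P}"
  then show ?thesis using finite_shared assms(1,2) unfolding shared_def by blast
qed (use lists in auto)

lemma finite_colours:
  assumes "M \<subseteq> T" "\<forall>P\<in>M. w P \<in> P" "S \<subseteq> merged M w"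
  shows "finite (colours S)"
  using assms finite_block[OF assms(1,2)] finite_subset[OF assms(3) finite_merged] by blast

lemma colourable_or_violator:
  assumes "M \<subseteq> T" "\<forall>P\<in>M. w P \<in> P" "\<not> part_colourable Q T L"
  obtains S where "S \<subseteq> merged M w" "card (colours S) < card S"
proof -
  have "part_colourable Q T L" if hall: "\<forall>S\<subseteq>merged M w. card S \<le> card (colours S)"
  proof (rule part_colourable_blocks[OF finite_merged _ _ _ hall])
    have "x \<in> \<Union>(blocks M w P)" if "x \<in> P" for x P
      using that by (cases "P \<in> M") (auto simp: blocks_def)
    then have "P \<subseteq> \<Union>(\<Union>P\<in>T. blocks M w P)" if "P \<in> T" for P
      using that by fast
    then show "Q \<union> \<Union>T \<subseteq> \<Union>(merged M w)" unfolding merged_def by auto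
    show "\<forall>B\<in>merged M w. (\<exists>x. B = {x}) \<or> (\<exists>P\<in>T. B \<subseteq> P)"
      using merged_block[OF assms(1,2)] assms(1) by blast
    show "\<forall>B\<in>merged M w. finite (\<Inter>x\<in>B. L x)"
      using finite_block[OF assms(1,2)] by blast
  qed
  then show thesis using assms(3) that by (meson not_le)
qed

lemma card_blocks_Int:
  assumes "P \<in> T"
  shows "card (S \<inter> blocks M w P) \<le> (if P \<in> M then 2 else 3)"
proof -
  have "card (blocks M w P) \<le> (if P \<in> M then 2 else 3)"
    using card_image_le[OF fin_triple[OF assms], of "\<lambda>x. {x}"] card_triple[OF assms]
    by (auto simp: blocks_def card_insert_if)
  moreover have "finite (blocks M w P)"
    using fin_triple[OF assms] by (simp add: blocks_def)
  ultimately show ?thesis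
    using card_mono[of "blocks M w P" "S \<inter> blocks M w P"] by (meson Int_lower2 le_trans)
qed

lemma card_merged_le:
  assumes "S \<subseteq> merged M w"
  shows "card S \<le> card Q + (\<Sum>P\<in>T. card (S \<inter> blocks M w P))"
proof -
  have "S = (S \<inter> (\<lambda>x. {x}) ` Q) \<union> (\<Union>P\<in>T. S \<inter> blocks M w P)"
    using assms by (auto simp: merged_def)
  then have "card S \<le> card (S \<inter> (\<lambda>x. {x}) ` Q) + card (\<Union>P\<in>T. S \<inter> blocks M w P)"
    by (metis card_Un_le)
  moreover have "card (S \<inter> (\<lambda>x. {x}) ` Q) \<le> card Q"
    using finQ by (meson Int_lower2 card_image_le card_mono finite_imageI le_trans)
  moreover have "card (\<Union>P\<in>T. S \<inter> blocks M w P) \<le> (\<Sum>P\<in>T. card (S \<inter> blocks M w P))"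
    by (rule card_UN_le[OF finT])
  ultimately show ?thesis by linarith
qed

lemma card_merged_bound:
  assumes "S \<subseteq> merged M w" "M \<subseteq> T" "\<forall>P\<in>T - M. card (S \<inter> blocks M w P) \<le> b"
  shows "card S \<le> card Q + 2 * card M + b * (card T - card M)"
proof -
  have "(\<Sum>P\<in>T. card (S \<inter> blocks M w P)) =
      (\<Sum>P\<in>T - M. card (S \<inter> blocks M w P)) + (\<Sum>P\<in>M. card (S \<inter> blocks M w P))"
    using assms(2) finT by (simp add: sum.subset_diff)
  moreover have "(\<Sum>P\<in>M. card (S \<inter> blocks M w P)) \<le> of_nat (card M) * 2"
  proof (rule sum_bounded_above)
    fix P assume "P \<in> M"
    then show "card (S \<inter> blocks M w P) \<le> 2"
      using card_blocks_Int[of P S M w] assms(2) by auto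
  qed
  moreover have "(\<Sum>P\<in>T - M. card (S \<inter> blocks M w P)) \<le> of_nat (card (T - M)) * b"
    using assms(3) by (intro sum_bounded_above) blast
  moreover have "card (T - M) = card T - card M"
    using assms(2) finT by (meson card_Diff_subset finite_subset)
  ultimately show ?thesis using card_merged_le[OF assms(1)] by (simp add: mult.commute)
qed

text \<open>A violator of Hall's condition that takes at most one block from each part has at most as many
  blocks as there are parts, and no more than a single list provides. So apart from violators
  made of merged pairs only, it takes two blocks from some part.\<close>

lemma violator_cases:
  assumes "M \<subseteq> T" "\<forall>P\<in>M. w P \<in> P" "S \<subseteq> merged M w" "card (colours S) < card S"
  obtains (pairs) "S \<subseteq> (\<lambda>P. P - {w P}) ` M"
    | (both) P where "P \<in> M" "P - {w P} \<in> S" "{w P} \<in> S"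
    | (split) P where "P \<in> T - M" "2 \<le> card (S \<inter> blocks M w P)"
proof -
  consider "S \<subseteq> (\<lambda>P. P - {w P}) ` M"
    | "\<exists>P\<in>T. 2 \<le> card (S \<inter> blocks M w P)"
    | "\<not> S \<subseteq> (\<lambda>P. P - {w P}) ` M" "\<forall>P\<in>T. \<not> 2 \<le> card (S \<inter> blocks M w P)"
    by blast
  then show thesis
  proof cases
    case 1
    then show ?thesis by (rule pairs)
  next
    case 2
    then obtain P where P: "P \<in> T" "2 \<le> card (S \<inter> blocks M w P)" by blast
    show ?thesis
    proof (cases "P \<in> M")
      case True
      have "P - {w P} \<in> S \<and> {w P} \<in> S"
      proof (rule ccontr)
        assume "\<not> ?thesis"
        then have "S \<inter> blocks M w P \<subseteq> {P - {w P}} \<or> S \<inter> blocks M w P \<subseteq> {{w P}}"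
          using True by (auto simp: blocks_def)
        then obtain B where B: "S \<inter> blocks M w P \<subseteq> {B}" by blast
        have "card (S \<inter> blocks M w P) \<le> card {B}" by (rule card_mono[OF _ B]) simp
        then show False using P by simp
      qed
      then show ?thesis using both True by blast
    qed (use split P in blast)
  next
    case 3
    then obtain B where "B \<in> S" "B \<notin> (\<lambda>P. P - {w P}) ` M" by blast
    then obtain x where x: "x \<in> Q \<union> \<Union>T" "{x} \<in> S"
      using merged_block[OF assms(1,2)] assms(3) by blast
    then have "L x \<subseteq> colours S" by auto
    then have "card (L x) \<le> card (colours S)"
      using finite_colours[OF assms(1-3)] by (rule card_mono[rotated])
    moreover have "(\<Sum>P\<in>T. card (S \<inter> blocks M w P)) \<le> of_nat (card T) * 1"
      using 3(2) by (intro sum_bounded_above) (simp add: not_le less_Suc_eq_le numeral_2_eq_2)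
    ultimately have False
      using card_merged_le[OF assms(3)] lists[OF x(1)] assms(4) by simp
    then show ?thesis ..
  qed
qed

lemma L_subset_colours: "{x} \<in> S \<Longrightarrow> L x \<subseteq> colours S"
  by auto

lemma shared_subset_colours: "P - {w} \<in> S \<Longrightarrow> shared P w \<subseteq> colours S"
  by (auto simp: shared_def)

lemma split_unmerged:
  assumes "P \<in> T - M" "2 \<le> card (S \<inter> blocks M w P)"
  obtains u v z where "P = {u, v, z}" "u \<noteq> v" "u \<noteq> z" "v \<noteq> z" "{u} \<in> S" "{v} \<in> S"
proof -
  define X where "X = {x\<in>P. {x} \<in> S}"
  have "S \<inter> blocks M w P = (\<lambda>x. {x}) ` X"
    using assms(1) by (auto simp: blocks_def X_def)
  then have "2 \<le> card X"
    using assms(2) by (simp add: card_image)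
  then obtain Y where "Y \<subseteq> X" "card Y = 2"
    by (meson obtain_subset_with_card_n)
  then obtain u v where uv: "u \<in> X" "v \<in> X" "u \<noteq> v"
    by (auto simp: card_2_iff)
  then have "card (P - {u, v}) = 1"
    using assms(1) card_triple[of P] by (simp add: X_def card_Diff_subset)
  then obtain z where "P - {u, v} = {z}" by (auto simp: card_1_singleton_iff)
  then show thesis using that[of u v z] uv by (auto simp: X_def)
qed

text \<open>A violator \<open>S\<close> meeting each unmerged triple at most once has at most
  \<open>card Q + card T + card M\<close> blocks, and a merged pair with its third vertex sees that many colours.
  A violator that contains two vertices of an unmerged triple sees nearly two full lists, and one that
  contains all three sees nearly three; the numerical conditions on \<open>b\<close> are exactly what
  the resulting two inequalities require.\<close>

lemma colourable_merging:
  assumes M: "M \<subseteq> T" "\<forall>P\<in>M. w P \<in> P"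
    and high: "\<forall>P\<in>M. card M \<le> card (shared P (w P))"
    and low: "\<forall>P\<in>T - M. \<forall>x\<in>P. card (shared P x) \<le> b"
    and num: "M = T \<or> (b \<le> card Q \<and> 3 * b \<le> 2 * card Q + card M)"
  shows "part_colourable Q T L"
proof (rule ccontr)
  assume "\<not> part_colourable Q T L"
  then obtain S where S: "S \<subseteq> merged M w" and viol: "card (colours S) < card S"
    using colourable_or_violator[OF M] by blast
  note fin = finite_colours[OF M S]
  have finM: "finite M" using M(1) finT finite_subset by blast
  have rT: "card M \<le> card T" using M(1) finT card_mono by blast
  show False
  proof (cases "\<exists>P\<in>T - M. 2 \<le> card (S \<inter> blocks M w P)")
    case False
    then have "\<forall>P\<in>T - M. card (S \<inter> blocks M w P) \<le> 1"
      by (simp add: not_le less_Suc_eq_le numeral_2_eq_2)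
    then have bound: "card S \<le> card Q + card T + card M"
      using card_merged_bound[OF S M(1), of 1] rT by simp
    show False
      using M S viol
    proof (cases rule: violator_cases)
      case pairs
      have "S \<noteq> {}" using viol by auto
      then obtain P where P: "P \<in> M" "P - {w P} \<in> S" using pairs by blast
      have "card M \<le> card (colours S)"
        using high P card_mono[OF fin shared_subset_colours[OF P(2)]] by fastforce
      moreover have "card S \<le> card M"
        using pairs finM by (meson card_image_le card_mono finite_imageI le_trans)
      ultimately show False using viol by simp
    next
      case (both P)
      have "shared P (w P) \<union> L (w P) \<subseteq> colours S"
        using L_subset_colours[OF both(3)] shared_subset_colours[OF both(2)] by blast
      then have "card (shared P (w P) \<union> L (w P)) \<le> card (colours S)"
        by (rule card_mono[OF fin])
      then show False
        using card_kept[of P "w P"] both(1) M high bound viol by fastforce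
    next
      case (split P)
      then show False using False by blast
    qed
  next
    case True
    then obtain P1 where P1: "P1 \<in> T - M" "2 \<le> card (S \<inter> blocks M w P1)" by blast
    then have num': "b \<le> card Q" "3 * b \<le> 2 * card Q + card M" using num by auto
    show False
    proof (cases "\<exists>P\<in>T - M. \<forall>x\<in>P. {x} \<in> S")
      case True
      then obtain P where P: "P \<in> T - M" "\<forall>x\<in>P. {x} \<in> S" by blast
      obtain u v z where eq: "P = {u, v, z}" "u \<noteq> v" "v \<noteq> z" "u \<noteq> z"
        using card_triple[of P] P(1) by (auto simp: card_3_iff)
      have "L u \<union> L v \<union> L z \<subseteq> colours S"
        using P(2) eq(1) L_subset_colours by (metis Un_least insertCI)
      then have "card (L u \<union> L v \<union> L z) \<le> card (colours S)" by (rule card_mono[OF fin])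
      moreover have "card (shared P u) \<le> b" "card (shared P v) \<le> b" "card (shared P z) \<le> b"
        using low P(1) eq(1) by auto
      moreover have "card S \<le> card Q + 2 * card M + 3 * (card T - card M)"
      proof (rule card_merged_bound[OF S M(1)], intro ballI)
        fix P assume "P \<in> T - M"
        then show "card (S \<inter> blocks M w P) \<le> 3" using card_blocks_Int[of P S M w] by auto
      qed
      ultimately show False
        using card_three_lists[OF eq(1) _ eq(2,4,3)] P(1) viol num' rT by auto
    next
      case False
      have "card (S \<inter> blocks M w P) \<le> 2" if P: "P \<in> T - M" for P
      proof -
        obtain x where "x \<in> P" "{x} \<notin> S" using False P by blast
        then have "S \<inter> blocks M w P \<subseteq> (\<lambda>x. {x}) ` (P - {x})"
          using P by (auto simp: blocks_def)
        moreover have "finite ((\<lambda>x. {x}) ` (P - {x}))" using P fin_triple by simp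
        ultimately have "card (S \<inter> blocks M w P) \<le> card ((\<lambda>x. {x}) ` (P - {x}))"
          by (rule card_mono[rotated])
        also have "\<dots> = 2"
          using P card_triple fin_triple \<open>x \<in> P\<close> by (simp add: card_image)
        finally show ?thesis .
      qed
      then have bound: "card S \<le> card Q + 2 * card M + 2 * (card T - card M)"
        using card_merged_bound[OF S M(1), of 2] by blast
      obtain u v z where eq: "P1 = {u, v, z}" "u \<noteq> v" "u \<noteq> z" "v \<noteq> z"
        and in_S: "{u} \<in> S" "{v} \<in> S"
        using split_unmerged[OF P1] .
      have "L u \<union> L v \<subseteq> colours S" using L_subset_colours in_S by blast
      then have "card (L u \<union> L v) \<le> card (colours S)" by (rule card_mono[OF fin])
      moreover have "card (shared P1 z) \<le> b" using low P1(1) eq(1) by auto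
      ultimately show False
        using card_two_lists[OF eq(1) _ eq(2-4)] P1(1) viol num' bound rT by auto
    qed
  qed
qed

text \<open>In every triple the pair with the largest intersection is chosen.\<close>

lemma merge_by_h_index:
  obtains M w where "M \<subseteq> T" "\<forall>P\<in>T. w P \<in> P"
    "\<forall>P\<in>M. card M \<le> card (shared P (w P))"
    "\<forall>P\<in>T - M. \<forall>x\<in>P. card (shared P x) \<le> card M"
proof -
  define m where "m P = Max ((\<lambda>x. card (shared P x)) ` P)" for P
  have "\<exists>x\<in>P. card (shared P x) = m P" if "P \<in> T" for P
  proof -
    have "m P \<in> (\<lambda>x. card (shared P x)) ` P"
      unfolding m_def using that fin_triple card_triple by (intro Max_in) force+
    then show ?thesis by auto
  qed
  then obtain w where w: "\<forall>P\<in>T. w P \<in> P \<and> card (shared P (w P)) = m P" by metis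
  have le: "card (shared P x) \<le> m P" if "P \<in> T" "x \<in> P" for P x
    unfolding m_def using that fin_triple by (intro Max_ge) auto
  obtain M where M: "M \<subseteq> T" "\<forall>P\<in>M. card M \<le> m P" "\<forall>P\<in>T - M. m P \<le> card M"
    using h_index[OF finT, of m] by blast
  show thesis
  proof (rule that[of M w])
    show "\<forall>P\<in>M. card M \<le> card (shared P (w P))" using M w by (metis subsetD)
    show "\<forall>P\<in>T - M. \<forall>x\<in>P. card (shared P x) \<le> card M"
      using M(3) le by (meson DiffD1 le_trans)
  qed (use M w in auto)
qed

text \<open>If the h-index \<open>r\<close> is less than \<open>card T\<close>, then \<open>r \<le> card Q\<close>, which is the numerical condition
  for \<open>b = r\<close>.\<close>

lemma colourable_few_triples:
  assumes "card T \<le> card Q + 1"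
  shows "part_colourable Q T L"
proof -
  obtain M w where Mw: "M \<subseteq> T" "\<forall>P\<in>T. w P \<in> P" "\<forall>P\<in>M. card M \<le> card (shared P (w P))"
    "\<forall>P\<in>T - M. \<forall>x\<in>P. card (shared P x) \<le> card M"
    using merge_by_h_index .
  have "M = T \<or> card M < card T"
    using Mw(1) finT by (metis psubsetI psubset_card_mono)
  then have "M = T \<or> (card M \<le> card Q \<and> 3 * card M \<le> 2 * card Q + card M)"
    using assms by auto
  then show ?thesis using colourable_merging[OF Mw(1) _ Mw(3,4)] Mw(1,2) by blast
qed

section \<open>Two more triples than singletons\<close>

text \<open>The colours that remain visible once \<open>P\<close> is merged so that \<open>w\<close> stays single. The union is
  disjoint, which makes it large.\<close>

abbreviation kept :: "'v set \<Rightarrow> 'v \<Rightarrow> 'c set" where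
  "kept P w \<equiv> shared P w \<union> L w"

text \<open>With all triples merged there are \<open>3 * card Q + 4\<close> blocks. A violator consisting of merged pairs
  only must contain all of them, and one that contains both blocks of a triple must contain all
  blocks; in both cases each inequality on the way is an equality.\<close>

lemma merge_all_tight:
  assumes T: "card T = card Q + 2" and not_col: "\<not> part_colourable Q T L"
    and w: "\<forall>P\<in>T. w P \<in> P" and high: "\<forall>P\<in>T. card Q + 1 \<le> card (shared P (w P))"
  obtains (pairs) A where "card A = card Q + 1" "\<forall>P\<in>T. shared P (w P) = A"
    | (all) R where "card R = 3 * (card Q + 1)" "\<forall>P\<in>T. kept P (w P) = R" "\<forall>x\<in>Q. L x \<subseteq> R"
proof -
  obtain S where S: "S \<subseteq> merged T w" and viol: "card (colours S) < card S"
    using colourable_or_violator[OF order.refl w not_col] .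
  note fin = finite_colours[OF order.refl w S]
  have total: "card S' \<le> 3 * card Q + 4" if "S' \<subseteq> merged T w" for S'
    using card_merged_bound[OF that, of 0] T by simp
  have sub: "shared P (w P) \<subseteq> colours S" if "P - {w P} \<in> S" for P
    using shared_subset_colours[OF that] .
  show thesis
    using order.refl w S viol
  proof (cases rule: violator_cases)
    case pairs
    have "S \<noteq> {}" using viol by auto
    then obtain P where P: "P \<in> T" "P - {w P} \<in> S" using pairs by blast
    have ge: "card Q + 1 \<le> card (colours S)"
      using high P(1) card_mono[OF fin sub[OF P(2)]] by fastforce
    have "card ((\<lambda>P. P - {w P}) ` T) \<le> card S"
      using card_image_le[OF finT, of "\<lambda>P. P - {w P}"] ge viol T by linarith
    then have S_eq: "S = (\<lambda>P. P - {w P}) ` T"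
      using pairs finT by (intro card_seteq) auto
    have "card S \<le> card Q + 2"
      unfolding S_eq using card_image_le[OF finT, of "\<lambda>P. P - {w P}"] T by simp
    then have "card (colours S) = card Q + 1" using ge viol by simp
    moreover have "shared P (w P) = colours S" if "P \<in> T" for P
      using sub[of P] that high calculation S_eq by (intro card_seteq[OF fin]) auto
    ultimately show thesis using that(1) by blast
  next
    case (both P)
    have "kept P (w P) \<subseteq> colours S"
      using sub[OF both(2)] L_subset_colours[OF both(3)] by blast
    then have "card (kept P (w P)) \<le> card (colours S)" by (rule card_mono[OF fin])
    then have "3 * card Q + 3 \<le> card (colours S)"
      using card_kept[of P "w P"] both(1) w high T by fastforce
    then have tight: "card (colours S) = 3 * (card Q + 1)" "card S = 3 * card Q + 4"
      using total[OF S] viol by auto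
    then have S_eq: "S = merged T w"
      using total[OF order.refl] by (intro card_seteq finite_merged S) simp
    have "kept P (w P) = colours S" if "P \<in> T" for P
    proof (rule card_seteq[OF fin])
      have "P - {w P} \<in> S" "{w P} \<in> S"
        unfolding S_eq merged_def using that by (auto simp: blocks_def)
      then show "kept P (w P) \<subseteq> colours S" using sub L_subset_colours by blast
      show "card (colours S) \<le> card (kept P (w P))"
        using card_kept[of P "w P"] that w high T tight by fastforce
    qed
    moreover have "L x \<subseteq> colours S" if "x \<in> Q" for x
      using that L_subset_colours[of x S] by (auto simp: S_eq merged_def)
    ultimately show thesis using that(2)[of "colours S"] tight(1) by blast
  next
    case (split P)
    then show thesis by blast
  qed
qed

text \<open>Here \<open>w0\<close> names the only pair of \<open>P0\<close> that can share \<open>card Q + 1\<close> colours. A violator must contain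
  exactly that pair from \<open>P0\<close>, since any other selection from \<open>P0\<close> either sees too many colours
  or is too small, and then it must contain all blocks of the other triples.\<close>

lemma merge_all_but_one_tight:
  assumes T: "card T = card Q + 2" and not_col: "\<not> part_colourable Q T L"
    and P0: "P0 \<in> T" "w0 \<in> P0" "card (shared P0 w0) \<le> card Q + 1"
      "\<forall>x\<in>P0 - {w0}. card (shared P0 x) \<le> card Q"
    and w: "\<forall>P\<in>T - {P0}. w P \<in> P"
    and high: "\<forall>P\<in>T - {P0}. card Q + 1 \<le> card (shared P (w P))"
    and P: "P \<in> T - {P0}"
  shows "kept P (w P) = (\<Union>x\<in>P0 - {w0}. L x)"
proof -
  define M where "M = T - {P0}"
  have M: "M \<subseteq> T" "\<forall>P\<in>M. w P \<in> P" and cM: "card M = card Q + 1" and TM: "T - M = {P0}"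
    using w P0(1) T finT by (auto simp: M_def)
  obtain S where S: "S \<subseteq> merged M w" and viol: "card (colours S) < card S"
    using colourable_or_violator[OF M not_col] .
  note fin = finite_colours[OF M S]
  have sub: "shared P (w P) \<subseteq> colours S" if "P - {w P} \<in> S" for P
    using shared_subset_colours[OF that] .
  have bound: "card S \<le> 3 * card Q + 2 + card (S \<inter> blocks M w P0)"
    using card_merged_bound[OF S M(1), of "card (S \<inter> blocks M w P0)"] TM cM T by simp
  have kept3: "3 * card Q + 3 \<le> card (kept P (w P))" if "P \<in> M" for P
  proof -
    have "P \<in> T" "w P \<in> P" "card Q + 1 \<le> card (shared P (w P))"
      using that w high by (auto simp: M_def)
    then show ?thesis using card_kept[of P "w P"] T by linarith
  qed
  \<comment> \<open>With at most one vertex of \<open>P0\<close> the violator is too small.\<close>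
  have two: "2 \<le> card (S \<inter> blocks M w P0)"
    using M S viol
  proof (cases rule: violator_cases)
    case pairs
    have "S \<noteq> {}" using viol by auto
    then obtain P where P: "P \<in> M" "P - {w P} \<in> S" using pairs by blast
    have "card Q + 1 \<le> card (shared P (w P))" using high P(1) by (simp add: M_def)
    then have "card Q + 1 \<le> card (colours S)"
      using card_mono[OF fin sub[OF P(2)]] by linarith
    moreover have "finite M" using finT M_def by simp
    then have "card S \<le> card M"
      using pairs by (meson card_image_le card_mono finite_imageI le_trans)
    ultimately show ?thesis using viol cM by simp
  next
    case (both P)
    have "kept P (w P) \<subseteq> colours S"
      using sub[OF both(2)] L_subset_colours[OF both(3)] by blast
    then have "card (kept P (w P)) \<le> card (colours S)" by (rule card_mono[OF fin])
    then show ?thesis using kept3[OF both(1)] viol bound by linarith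
  next
    case (split P)
    then show ?thesis using TM by auto
  qed
  obtain u v z where eq: "P0 = {u, v, z}" "u \<noteq> v" "u \<noteq> z" "v \<noteq> z" and uv: "{u} \<in> S" "{v} \<in> S"
    using split_unmerged[OF _ two] TM by blast
  have sub2: "L u \<union> L v \<subseteq> colours S" using uv L_subset_colours by blast
  have "{z} \<notin> S"
  proof
    assume "{z} \<in> S"
    then have "L u \<union> L v \<union> L z \<subseteq> colours S" using sub2 L_subset_colours by blast
    then have "card (L u \<union> L v \<union> L z) \<le> card (colours S)" by (rule card_mono[OF fin])
    moreover have "card (shared P0 u) + card (shared P0 v) + card (shared P0 z) \<le> 3 * card Q + 1"
    proof -
      have c: "card (shared P0 x) \<le> card Q + (if x = w0 then 1 else 0)" if "x \<in> P0" for x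
        using P0(3,4) that by auto
      have "u \<in> P0" "v \<in> P0" "z \<in> P0" using eq(1) by blast+
      from this[THEN c] show ?thesis using eq(2-4) by (simp split: if_splits)
    qed
    moreover have "card (S \<inter> blocks M w P0) \<le> 3"
      using card_blocks_Int[OF P0(1), of S M w] by (simp add: M_def)
    ultimately show False
      using card_three_lists[OF eq(1) P0(1) eq(2-4)] viol bound T by linarith
  qed
  have "S \<inter> blocks M w P0 \<subseteq> {{u}, {v}}"
    using \<open>{z} \<notin> S\<close> eq(1) by (auto simp: blocks_def M_def)
  then have "card (S \<inter> blocks M w P0) \<le> card {{u}, {v}}" by (intro card_mono) auto
  then have two_eq: "card (S \<inter> blocks M w P0) = 2" using two eq(2) by simp
  have le: "card (L u \<union> L v) \<le> card (colours S)" by (rule card_mono[OF fin sub2])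
  have "z = w0"
  proof (rule ccontr)
    assume "z \<noteq> w0"
    then have "card (shared P0 z) \<le> card Q" using P0(4) eq(1) by blast
    then show False
      using card_two_lists[OF eq(1) P0(1) eq(2-4)] le viol bound two_eq T by linarith
  qed
  then have ge: "3 * card Q + 3 \<le> card (L u \<union> L v)"
    using card_two_lists[OF eq(1) P0(1) eq(2-4)] P0(3) T by simp
  then have tight: "card (colours S) = 3 * card Q + 3" "card S = 3 * card Q + 4"
    using le viol bound two_eq by linarith+
  have "L u \<union> L v = colours S"
    using ge tight by (intro card_seteq[OF fin sub2]) simp_all
  moreover have "P0 - {w0} = {u, v}" using eq \<open>z = w0\<close> by auto
  ultimately have E: "(\<Union>x\<in>P0 - {w0}. L x) = colours S" by simp
  have PM: "P \<in> M" using P by (simp add: M_def)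
  have "{P - {w P}, {w P}} \<subseteq> S"
  proof (rule ccontr)
    assume "\<not> ?thesis"
    then have "S \<inter> blocks M w P \<subset> {P - {w P}, {w P}}"
      using PM by (auto simp: blocks_def)
    then have "card (S \<inter> blocks M w P) < card {P - {w P}, {w P}}"
      by (intro psubset_card_mono) auto
    also have "\<dots> \<le> 2" by (simp add: card_insert_if)
    finally have one: "card (S \<inter> blocks M w P) < 2" .
    \<comment> \<open>The size of \<open>S\<close> leaves no room for a missing block.\<close>
    have "(\<Sum>P\<in>T. card (S \<inter> blocks M w P)) < (\<Sum>P\<in>T. 2)"
    proof (rule sum_strict_mono_ex1[OF finT])
      show "\<forall>P\<in>T. card (S \<inter> blocks M w P) \<le> 2"
      proof
        fix P assume "P \<in> T"
        then show "card (S \<inter> blocks M w P) \<le> 2"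
          using card_blocks_Int[of P S M w] two_eq by (cases "P = P0") (auto simp: M_def)
      qed
      show "\<exists>P\<in>T. card (S \<inter> blocks M w P) < 2" using one P by blast
    qed
    then show False using card_merged_le[OF S] tight(2) T by simp
  qed
  then have "kept P (w P) \<subseteq> colours S" using sub L_subset_colours by blast
  then show ?thesis
    unfolding E using kept3[OF PM] tight(1) by (intro card_seteq[OF fin]) simp_all
qed

text \<open>Call a pair in a triple good if it shares \<open>card Q + 1\<close> colours. Every triple has a good pair, by
  the choice of merged triples via the h-index. Two good pairs of the same triple share
  different colours, so a triple with two good pairs is flexible. If some triple had only one,
  the two tightness lemmas would first spread this to all triples and then give two
  incompatible values for what a third triple keeps. Hence all triples are flexible, the alternative with
  equal intersections can always be avoided, and all triples keep the same set \<open>R\<close> of colours.\<close>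

lemma card_colours_if_not_colourable:
  assumes T: "card T = card Q + 2" "3 \<le> card T" and not_col: "\<not> part_colourable Q T L"
  shows "card (\<Union>x\<in>Q \<union> \<Union>T. L x) = 3 * (card Q + 1)"
proof -
  define good where "good P x \<longleftrightarrow> x \<in> P \<and> card Q + 1 \<le> card (shared P x)" for P x
  have ex: "\<exists>x. good P x" if P: "P \<in> T" for P
  proof -
    obtain M w where Mw: "M \<subseteq> T" "\<forall>P\<in>T. w P \<in> P" "\<forall>P\<in>M. card M \<le> card (shared P (w P))"
      "\<forall>P\<in>T - M. \<forall>x\<in>P. card (shared P x) \<le> card M"
      using merge_by_h_index .
    have wM: "\<forall>P\<in>M. w P \<in> P" using Mw(1,2) by blast
    note merging = colourable_merging[OF Mw(1) wM Mw(3)]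
    have "M \<noteq> T" using merging[of "card M"] Mw(4) not_col by blast
    then have "card M < card T" using Mw(1) finT by (metis psubsetI psubset_card_mono)
    moreover have "\<not> card M \<le> card Q" using merging[OF Mw(4)] not_col by auto
    ultimately have cM: "card M = card Q + 1" using T by linarith
    show ?thesis
    proof (cases "P \<in> M")
      case True
      then show ?thesis using Mw(3) wM cM unfolding good_def by metis
    next
      case False
      have "card (T - M) = 1"
        using cM T Mw(1) finT by (simp add: card_Diff_subset finite_subset)
      then have TM: "T - M = {P}" using P False by (auto simp: card_1_singleton_iff)
      show ?thesis
      proof (rule ccontr)
        assume "\<not> ?thesis"
        then have "\<forall>P\<in>T - M. \<forall>x\<in>P. card (shared P x) \<le> card Q"
          unfolding TM good_def by (simp add: not_le less_Suc_eq_le)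
        then show False using merging[of "card Q"] not_col cM by auto
      qed
    qed
  qed
  then obtain g where g: "\<forall>P\<in>T. good P (g P)" by metis
  have tight: "(\<exists>A. card A = card Q + 1 \<and> (\<forall>P\<in>T. shared P (w P) = A)) \<or>
      (\<exists>R. card R = 3 * (card Q + 1) \<and> (\<forall>P\<in>T. kept P (w P) = R) \<and> (\<forall>x\<in>Q. L x \<subseteq> R))"
    if "\<forall>P\<in>T. good P (w P)" for w
  proof -
    have w: "\<forall>P\<in>T. w P \<in> P" "\<forall>P\<in>T. card Q + 1 \<le> card (shared P (w P))"
      using that by (auto simp: good_def)
    show ?thesis by (rule merge_all_tight[OF T(1) not_col w]) blast+
  qed
  \<comment> \<open>A larger intersection is incompatible with both alternatives of tightness.\<close>
  have exact: "card (shared P x) = card Q + 1" if P: "P \<in> T" "good P x" for P x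
  proof -
    have "\<forall>P'\<in>T. good P' ((g(P := x)) P')" using g P by simp
    from tight[OF this] have "card (shared P x) = card Q + 1 \<or> card (kept P x) = 3 * (card Q + 1)"
      using P(1) by force
    then show ?thesis using card_kept[of P x] P T(1) by (auto simp: good_def)
  qed
  have differ: "shared P x \<noteq> shared P y" if "P \<in> T" "good P x" "good P y" "x \<noteq> y" for P x y
    using shared_shared_disjoint[of P x y] that exact[of P x] by (auto simp: good_def)
  have third: "\<exists>P''\<in>T. P'' \<noteq> P \<and> P'' \<noteq> P'" for P P'
  proof (rule ccontr)
    assume "\<not> ?thesis"
    then have "T \<subseteq> {P, P'}" by blast
    then have "card T \<le> card {P, P'}" by (intro card_mono) auto
    also have "\<dots> \<le> 2" by (simp add: card_insert_if)
    finally show False using T(2) by simp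
  qed
  define rest where "rest P = (\<Union>x\<in>P - {g P}. L x)" for P
  \<comment> \<open>Now \<open>P\<close> is a triple with only one good pair. If the third list were contained in the union
    of the other two, it would be covered by two intersections that are not good.\<close>
  have unique_tight: "kept P' x = rest P" "kept P (g P) \<noteq> rest P"
    if P: "P \<in> T" "\<forall>x. good P x \<longrightarrow> x = g P" and P': "P' \<in> T" "P' \<noteq> P" "good P' x" for P P' x
  proof -
    have gP: "g P \<in> P" using g P(1) good_def by blast
    have low: "\<forall>x\<in>P - {g P}. card (shared P x) \<le> card Q"
      using P(2) by (force simp: good_def)
    have le: "card (shared P (g P)) \<le> card Q + 1" using exact P(1) g by simp
    define w where "w = g(P' := x)"
    have w: "good P'' (w P'')" if "P'' \<in> T" for P'' using g P' that by (simp add: w_def)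
    then have w': "\<forall>P\<in>T - {P}. w P \<in> P" "\<forall>P\<in>T - {P}. card Q + 1 \<le> card (shared P (w P))"
      by (auto simp: good_def)
    have "P' \<in> T - {P}" using P' by blast
    from merge_all_but_one_tight[OF T(1) not_col P(1) gP le low w' this]
    show "kept P' x = rest P" by (simp add: rest_def w_def)
    obtain u v where eq: "P = {u, v, g P}" "u \<noteq> v" "u \<noteq> g P" "v \<noteq> g P"
      using triple_eq[OF P(1) gP] .
    have sh: "shared P u = L v \<inter> L (g P)" "shared P v = L u \<inter> L (g P)"
      using eq(2-4) shared_eq[of v u "g P"] shared_eq[of u v "g P"] eq(1)
      by (simp_all add: insert_commute shared_eq)
    have Pm: "P - {g P} = {u, v}" using eq by blast
    show "kept P (g P) \<noteq> rest P"
    proof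
      assume "kept P (g P) = rest P"
      then have "L (g P) \<subseteq> shared P u \<union> shared P v"
        unfolding rest_def Pm sh by auto
      moreover have "finite (shared P u \<union> shared P v)"
        using finite_shared[OF P(1)] eq(1) by blast
      ultimately have "card (L (g P)) \<le> card (shared P u \<union> shared P v)"
        by (rule card_mono[rotated])
      also have "\<dots> \<le> card (shared P u) + card (shared P v)" by (rule card_Un_le)
      also have "\<dots> \<le> 2 * card Q" using low Pm by auto
      finally show False using in_lists(2)[OF P(1) gP] T(1) by simp
    qed
  qed
  \<comment> \<open>If some triple has only one good pair, all choices of good pairs share one and the same
    set of colours, so every triple has only one good pair.\<close>
  have other: "\<exists>y. good P y \<and> y \<noteq> x" if P: "P \<in> T" "good P x" for P x
  proof (rule ccontr)
    assume "\<not> ?thesis"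
    then have uniq0: "\<forall>y. good P y \<longrightarrow> y = g P" using g P by metis
    have equal: "shared P1 x = shared P2 y"
      if "P1 \<in> T" "P2 \<in> T" "P1 \<noteq> P2" "good P1 x" "good P2 y" for P1 P2 x y
    proof -
      define h where "h = g(P1 := x, P2 := y)"
      have h: "\<forall>P\<in>T. good P (h P)" using g that by (auto simp: h_def)
      obtain P' where P': "P' \<in> T" "P' \<noteq> P" using third by blast
      have "h P = g P" using h uniq0 P(1) by blast
      then have "kept P (h P) \<noteq> kept P' (h P')"
        using unique_tight[OF P(1) uniq0 P'] h P'(1) by metis
      then obtain A where "\<forall>P\<in>T. shared P (h P) = A" using tight[OF h] P(1) P'(1) by metis
      then have "shared P1 (h P1) = shared P2 (h P2)" using that by metis
      then show ?thesis using that(3) by (simp add: h_def)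
    qed
    have uniq: "\<forall>y. good P' y \<longrightarrow> y = g P'" if P': "P' \<in> T" for P'
    proof -
      obtain P'' where "P'' \<in> T" "P'' \<noteq> P'" using third by blast
      then show ?thesis using equal[OF P'] differ[OF P'] g P' by metis
    qed
    obtain P1 where P1: "P1 \<in> T" "P1 \<noteq> P" using third by blast
    obtain P2 where P2: "P2 \<in> T" "P2 \<noteq> P" "P2 \<noteq> P1" using third by blast
    have "kept P1 (g P1) = kept P2 (g P2)"
      using unique_tight(1)[OF P(1) uniq0] P1 P2 g by metis
    also have "\<dots> = rest P1"
      using unique_tight(1)[OF P1(1) uniq[OF P1(1)] P2(1,3)] g P2 by blast
    finally show False
      using unique_tight(2)[OF P1(1) uniq[OF P1(1)] P2(1,3)] g P2 by blast
  qed
  \<comment> \<open>A third triple whose chosen pair shares other colours than the one of \<open>P\<close> excludes the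
    alternative of equal intersections.\<close>
  have pair: "kept P x = kept P' y \<and> card (kept P x) = 3 * (card Q + 1) \<and> (\<forall>v\<in>Q. L v \<subseteq> kept P x)"
    if P: "P \<in> T" "good P x" and P': "P' \<in> T" "good P' y" "P' \<noteq> P" for P P' x y
  proof -
    obtain P'' where P'': "P'' \<in> T" "P'' \<noteq> P" "P'' \<noteq> P'" using third by blast
    obtain z z' where z: "good P'' z" "good P'' z'" "z \<noteq> z'"
      using other[OF P''(1)] g P''(1) by metis
    then have "shared P'' z \<noteq> shared P x \<or> shared P'' z' \<noteq> shared P x"
      using differ[OF P''(1)] by metis
    then obtain t where t: "good P'' t" "shared P'' t \<noteq> shared P x" using z by blast
    define h where "h = g(P := x, P' := y, P'' := t)"
    have h: "\<forall>P\<in>T. good P (h P)" using g P P' t by (auto simp: h_def)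
    have hv: "h P = x" "h P' = y" "h P'' = t" using P'(3) P'' by (auto simp: h_def)
    then show ?thesis using tight[OF h] t(2) P(1) P'(1) P''(1) by metis
  qed
  obtain P0 where P0: "P0 \<in> T" using third by blast
  obtain P1 where P1: "P1 \<in> T" "P1 \<noteq> P0" using third by blast
  define R where "R = kept P1 (g P1)"
  have R0: "kept P0 (g P0) = R" "card R = 3 * (card Q + 1)" "\<forall>v\<in>Q. L v \<subseteq> R"
    using pair[OF P0 _ P1(1) _ P1(2), of "g P0" "g P1"] g P0 P1 by (auto simp: R_def)
  have R: "kept P x = R" if "P \<in> T" "good P x" for P x
  proof (cases "P = P1")
    case True
    then show ?thesis using pair[OF that P0 _ _, of "g P0"] g P0 P1 R0(1) by metis
  next
    case False
    then show ?thesis using pair[OF that P1(1) _ _, of "g P1"] g P1 R_def by metis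
  qed
  have finR: "finite R" using R0(2) by (intro card_ge_0_finite) simp
  have "L v \<subseteq> R" if v: "P \<in> T" "v \<in> P" for P v
  proof (cases "good P v")
    case True
    then show ?thesis using R[OF v(1)] by blast
  next
    case False
    \<comment> \<open>Both other lists lie in \<open>R\<close>, which is too small for them unless they share enough colours.\<close>
    obtain x y where xy: "good P x" "good P y" "x \<noteq> y" using other ex v(1) by metis
    then have ne: "x \<noteq> v" "y \<noteq> v" using False by auto
    have xyP: "x \<in> P" "y \<in> P" using xy by (auto simp: good_def)
    have "card {x, y, v} = card P" using card_triple[OF v(1)] xy(3) ne by simp
    then have eq: "P = {x, y, v}"
      using xyP v fin_triple[OF v(1)] by (metis card_subset_eq empty_subsetI insert_subset)
    have "L x \<union> L y \<subseteq> R" using R[OF v(1)] xy by blast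
    then have "card (L x \<union> L y) \<le> card R" by (rule card_mono[OF finR])
    then have "good P v"
      using card_two_lists[OF eq v(1) xy(3) ne] R0(2) T(1) v(2) by (simp add: good_def)
    then show ?thesis using False by blast
  qed
  then have "(\<Union>x\<in>Q \<union> \<Union>T. L x) \<subseteq> R" using R0(3) by blast
  moreover have "R \<subseteq> (\<Union>x\<in>Q \<union> \<Union>T. L x)"
  proof -
    obtain u v where "P0 = {u, v, g P0}" "u \<noteq> v" "u \<noteq> g P0" "v \<noteq> g P0"
      using triple_eq[OF P0, of "g P0"] g P0 good_def by blast
    then have "shared P0 (g P0) \<subseteq> L u" "u \<in> P0" "g P0 \<in> P0"
      by (auto simp: shared_def)
    then show ?thesis using R0(1) P0 by blast
  qed
  ultimately show ?thesis using R0(2) by (metis equalityI)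
qed

end

section \<open>Triples with common colours and infinite lists\<close>

text \<open>Induction on the number of parts: a colour common to a triple is used for that triple and
  removed from all other lists, which lowers the number of parts and the list sizes by one. This
  preserves the hypothesis on the number of triples.\<close>

lemma part_colourable_few_triples:
  assumes "triple_system Q T" "card T \<le> card Q + 1"
    and "\<forall>x\<in>Q \<union> \<Union>T. finite (L x) \<and> card Q + card T \<le> card (L x)"
  shows "part_colourable Q T L"
  using assms
proof (induction "card Q + card T" arbitrary: Q T L rule: less_induct)
  case less
  note sys = less.prems(1) and few = less.prems(2) and lists = less.prems(3)
  have fin: "finite Q" "finite T" using sys by (auto simp: triple_system_def)
  have smaller: "card Q' + card T' \<le> card (L x - {c})"
    if "x \<in> Q \<union> \<Union>T" "card Q' + card T' < card Q + card T"
    for x c and Q' :: "'a set" and T' :: "'a set set"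
  proof -
    have "card (L x) \<le> Suc (card (L x - {c}))" by (auto simp: card_Diff_singleton_if)
    moreover have "card Q + card T \<le> card (L x)" using lists that by blast
    ultimately show ?thesis using that by linarith
  qed
  show ?case
  proof (cases "\<exists>P\<in>T. (\<Inter>x\<in>P. L x) \<noteq> {}")
    case True
    then obtain P c where P: "P \<in> T" and c: "\<forall>x\<in>P. c \<in> L x" by blast
    have "card T > 0" using fin P by (auto simp: card_gt_0_iff)
    then have cT: "card (T - {P}) + 1 = card T" using fin P by simp
    have "part_colourable Q (T - {P}) (\<lambda>x. L x - {c})"
    proof (rule less.hyps)
      show "triple_system Q (T - {P})"
        using sys by (auto simp: triple_system_def disjoint_def)
      show "\<forall>x\<in>Q \<union> \<Union>(T - {P}). finite (L x - {c}) \<and> card Q + card (T - {P}) \<le> card (L x - {c})"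
        using smaller[of _ Q "T - {P}" c] cT lists by auto
    qed (use cT few in auto)
    moreover have "P \<inter> Q = {}" "disjoint T" using sys P by (auto simp: triple_system_def)
    ultimately show ?thesis using part_colourable_add_triple c P by metis
  next
    case False
    then interpret spread_lists Q T L
      using sys lists by unfold_locales auto
    show ?thesis using colourable_few_triples few .
  qed
qed
lemma not_colourable_finite_lists:
  assumes sys: "triple_system Q T" and T: "card T = card Q + 2" "3 \<le> card T"
    and lists: "\<forall>x\<in>Q \<union> \<Union>T. finite (L x) \<and> card Q + card T \<le> card (L x)"
    and not_col: "\<not> part_colourable Q T L"
  shows "card (\<Union>x\<in>Q \<union> \<Union>T. L x) = 3 * (card Q + 1)" "\<forall>P\<in>T. (\<Inter>x\<in>P. L x) = {}"
proof -
  show spread: "\<forall>P\<in>T. (\<Inter>x\<in>P. L x) = {}"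
  proof (rule ccontr)
    assume "\<not> ?thesis"
    then obtain P c where P: "P \<in> T" and c: "\<forall>x\<in>P. c \<in> L x" by blast
    have cT: "card (T - {P}) = card Q + 1" using P T by simp
    have "part_colourable Q (T - {P}) (\<lambda>x. L x - {c})"
    proof (rule part_colourable_few_triples)
      show "triple_system Q (T - {P})"
        using sys by (auto simp: triple_system_def disjoint_def)
      show "\<forall>x\<in>Q \<union> \<Union>(T - {P}). finite (L x - {c}) \<and> card Q + card (T - {P}) \<le> card (L x - {c})"
      proof
        fix x assume "x \<in> Q \<union> \<Union>(T - {P})"
        then have "finite (L x)" "card Q + card T \<le> card (L x)" using lists by auto
        then show "finite (L x - {c}) \<and> card Q + card (T - {P}) \<le> card (L x - {c})"
          using cT T(1) by (auto simp: card_Diff_singleton_if)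
      qed
    qed (use cT in simp)
    moreover have "P \<inter> Q = {}" "disjoint T" using sys P by (auto simp: triple_system_def)
    ultimately show False using part_colourable_add_triple c P not_col by metis
  qed
  interpret spread_lists Q T L
    using sys lists spread by unfold_locales auto
  show "card (\<Union>x\<in>Q \<union> \<Union>T. L x) = 3 * (card Q + 1)"
    using card_colours_if_not_colourable T not_col .
qed

lemma obtain_finite_lists:
  fixes L :: "'v \<Rightarrow> 'c set"
  assumes "finite F" and "\<forall>x\<in>V. infinite (L x) \<or> k \<le> card (L x)"
  obtains L' where "\<forall>x\<in>V. L' x \<subseteq> L x \<and> finite (L' x) \<and> k \<le> card (L' x) \<and> L x \<inter> F \<subseteq> L' x"
proof -
  have "\<exists>A. A \<subseteq> L x \<and> finite A \<and> k \<le> card A \<and> L x \<inter> F \<subseteq> A" if x: "x \<in> V" for x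
  proof -
    have "\<exists>B. B \<subseteq> L x \<and> finite B \<and> card B = k"
    proof (cases "finite (L x)")
      case True
      then have "k \<le> card (L x)" using assms(2) x by blast
      then show ?thesis by (meson obtain_subset_with_card_n)
    next
      case False
      then show ?thesis using infinite_arbitrarily_large by blast
    qed
    then obtain B where B: "B \<subseteq> L x" "finite B" "card B = k" by blast
    have "card B \<le> card (B \<union> L x \<inter> F)"
      using B assms(1) by (intro card_mono) auto
    then show ?thesis using B assms(1) by (intro exI[of _ "B \<union> L x \<inter> F"]) auto
  qed
  then obtain L' where "\<forall>x\<in>V. L' x \<subseteq> L x \<and> finite (L' x) \<and> k \<le> card (L' x) \<and> L x \<inter> F \<subseteq> L' x"
    using bchoice[of V "\<lambda>x A. A \<subseteq> L x \<and> finite A \<and> k \<le> card A \<and> L x \<inter> F \<subseteq> A"] by blast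
  then show thesis using that by blast
qed

text \<open>Different parts use disjoint sets of colours, and a triple without a common colour needs two.\<close>

lemma card_colours_if_colourable:
  assumes sys: "triple_system Q T" and spread: "\<forall>P\<in>T. (\<Inter>x\<in>P. L x) = {}"
    and fin: "finite (\<Union>x\<in>Q \<union> \<Union>T. L x)" and col: "part_colourable Q T L"
  shows "card Q + 2 * card T \<le> card (\<Union>x\<in>Q \<union> \<Union>T. L x)"
proof -
  obtain f where f: "\<forall>x\<in>Q \<union> \<Union>T. f x \<in> L x"
    and sep: "\<forall>x\<in>Q \<union> \<Union>T. \<forall>y\<in>Q \<union> \<Union>T. f x = f y \<longrightarrow> x = y \<or> (\<exists>P\<in>T. x \<in> P \<and> y \<in> P)"
    using col unfolding part_colourable_def by blast
  have fins: "finite Q" "finite T" and disj: "disjoint T" "Q \<inter> \<Union>T = {}"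
    and three: "\<forall>P\<in>T. card P = 3"
    using sys by (auto simp: triple_system_def)
  have finP: "finite P" if "P \<in> T" for P
    using that three by (intro card_ge_0_finite) simp
  have two: "2 \<le> card (f ` P)" if P: "P \<in> T" for P
  proof (rule ccontr)
    assume "\<not> ?thesis"
    moreover have "card (f ` P) \<noteq> 0" using P three finP[OF P] by auto
    ultimately have "card (f ` P) = 1" by linarith
    then obtain c where c: "f ` P = {c}" by (auto simp: card_1_singleton_iff)
    have "c \<in> L x" if "x \<in> P" for x
    proof -
      have "f x = c" using c that by blast
      then show ?thesis using f P that by blast
    qed
    then show False using spread P by blast
  qed
  have same: "P = P'" if "P \<in> T" "P' \<in> T" "x \<in> P" "x \<in> P'" for P P' x
    using disj(1) that unfolding disjoint_def by blast
  have disjP: "f ` P \<inter> f ` P' = {}" if "P \<in> T" "P' \<in> T" "P \<noteq> P'" for P P'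
  proof (rule ccontr)
    assume "f ` P \<inter> f ` P' \<noteq> {}"
    then obtain x y where xy: "x \<in> P" "y \<in> P'" "f x = f y" by blast
    then have "x = y \<or> (\<exists>P\<in>T. x \<in> P \<and> y \<in> P)" using sep that by blast
    then show False using same that xy by metis
  qed
  have disjQ: "f ` Q \<inter> (\<Union>P\<in>T. f ` P) = {}"
  proof (rule ccontr)
    assume "f ` Q \<inter> (\<Union>P\<in>T. f ` P) \<noteq> {}"
    then obtain x y P where xy: "x \<in> Q" "y \<in> P" "P \<in> T" "f x = f y" by blast
    then have "x = y \<or> (\<exists>P\<in>T. x \<in> P \<and> y \<in> P)" using sep by blast
    then show False using disj(2) xy by blast
  qed
  have "inj_on f Q"
  proof (rule inj_onI)
    fix x y assume xy: "x \<in> Q" "y \<in> Q" "f x = f y"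
    then have "x = y \<or> (\<exists>P\<in>T. x \<in> P \<and> y \<in> P)" using sep by blast
    then show "x = y" using disj(2) xy by blast
  qed
  then have "card Q + (\<Sum>P\<in>T. card (f ` P)) = card (f ` Q \<union> (\<Union>P\<in>T. f ` P))"
    using fins finP disjP disjQ by (simp add: card_Un_disjoint card_UN_disjoint card_image)
  also have "\<dots> \<le> card (\<Union>x\<in>Q \<union> \<Union>T. L x)"
    using f by (intro card_mono[OF fin]) blast
  finally show ?thesis
    using sum_bounded_below[of T 2 "\<lambda>P. card (f ` P)"] two by simp
qed

text \<open>Both conclusions for arbitrary lists are tested on finite sets \<open>F\<close> of colours: truncating the
  lists so that all occurrences of colours from \<open>F\<close> are kept preserves non-colourability, and
  the truncated lists obey the finite case. Applied first to all finite sets of colours, this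
  bounds the number of colours; then the set of all colours is a possible \<open>F\<close>.\<close>

lemma not_colourable_iff:
  fixes L :: "'v \<Rightarrow> 'c set"
  assumes sys: "triple_system Q T" and T: "card T = card Q + 2" "3 \<le> card T"
    and lists: "\<forall>x\<in>Q \<union> \<Union>T. infinite (L x) \<or> card Q + card T \<le> card (L x)"
  shows "\<not> part_colourable Q T L \<longleftrightarrow>
    card (\<Union>x\<in>Q \<union> \<Union>T. L x) = 3 * (card Q + 1) \<and> (\<forall>P\<in>T. (\<Inter>x\<in>P. L x) = {})"
    (is "_ \<longleftrightarrow> ?number \<and> ?spread")
proof
  assume not_col: "\<not> part_colourable Q T L"
  define restricts where "restricts F L' \<longleftrightarrow>
      (\<forall>x\<in>Q \<union> \<Union>T. L' x \<subseteq> L x \<and> L x \<inter> F \<subseteq> L' x) \<and>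
      card (\<Union>x\<in>Q \<union> \<Union>T. L' x) = 3 * (card Q + 1) \<and> (\<forall>P\<in>T. (\<Inter>x\<in>P. L' x) = {})"
    for F :: "'c set" and L' :: "'v \<Rightarrow> 'c set"
  have restrict: "\<exists>L'. restricts F L'" if F: "finite F" for F
  proof -
    obtain L' where L': "\<forall>x\<in>Q \<union> \<Union>T. L' x \<subseteq> L x \<and> finite (L' x) \<and>
        card Q + card T \<le> card (L' x) \<and> L x \<inter> F \<subseteq> L' x"
      using obtain_finite_lists[OF F lists] .
    then have "\<not> part_colourable Q T L'"
      using part_colourable_mono[of Q T L' L] not_col by blast
    then have "card (\<Union>x\<in>Q \<union> \<Union>T. L' x) = 3 * (card Q + 1)" "\<forall>P\<in>T. (\<Inter>x\<in>P. L' x) = {}"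
      using not_colourable_finite_lists[OF sys T, of L'] L' by auto
    moreover have "\<forall>x\<in>Q \<union> \<Union>T. L' x \<subseteq> L x \<and> L x \<inter> F \<subseteq> L' x" using L' by simp
    ultimately have "restricts F L'" unfolding restricts_def by (intro conjI)
    then show ?thesis by blast
  qed
  have small: "finite F \<and> card F \<le> 3 * (card Q + 1)"
    if F: "finite F" "F \<subseteq> (\<Union>x\<in>Q \<union> \<Union>T. L x)" for F
  proof -
    obtain L' where "restricts F L'" using restrict[OF F(1)] by blast
    then have L': "\<forall>x\<in>Q \<union> \<Union>T. L x \<inter> F \<subseteq> L' x"
      "card (\<Union>x\<in>Q \<union> \<Union>T. L' x) = 3 * (card Q + 1)"
      by (simp_all add: restricts_def)
    have "F \<subseteq> (\<Union>x\<in>Q \<union> \<Union>T. L' x)"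
    proof
      fix c assume c: "c \<in> F"
      then obtain x where x: "x \<in> Q \<union> \<Union>T" "c \<in> L x" using F(2) by (meson UN_E subsetD)
      then have "c \<in> L' x" using L'(1) c by (meson IntI subsetD)
      then show "c \<in> (\<Union>x\<in>Q \<union> \<Union>T. L' x)" using x(1) by (rule UN_I[rotated])
    qed
    moreover have "finite (\<Union>x\<in>Q \<union> \<Union>T. L' x)" using L'(2) by (intro card_ge_0_finite) simp
    ultimately show ?thesis using L'(2) F(1) card_mono by metis
  qed
  have fin: "finite (\<Union>x\<in>Q \<union> \<Union>T. L x)"
  proof (rule ccontr)
    assume "infinite (\<Union>x\<in>Q \<union> \<Union>T. L x)"
    then obtain F where "finite F" "card F = 3 * (card Q + 1) + 1" "F \<subseteq> (\<Union>x\<in>Q \<union> \<Union>T. L x)"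
      using infinite_arbitrarily_large by blast
    then show False using small[of F] by simp
  qed
  obtain L' where "restricts (\<Union>x\<in>Q \<union> \<Union>T. L x) L'" using restrict[OF fin] by blast
  then have L': "\<forall>x\<in>Q \<union> \<Union>T. L' x \<subseteq> L x \<and> L x \<inter> (\<Union>x\<in>Q \<union> \<Union>T. L x) \<subseteq> L' x"
      "card (\<Union>x\<in>Q \<union> \<Union>T. L' x) = 3 * (card Q + 1)" "\<forall>P\<in>T. (\<Inter>x\<in>P. L' x) = {}"
    unfolding restricts_def by auto
  have same: "L' x = L x" if "x \<in> Q \<union> \<Union>T" for x
    using L'(1) that by (intro subset_antisym) (auto 4 3)
  have "(\<Union>x\<in>Q \<union> \<Union>T. L' x) = (\<Union>x\<in>Q \<union> \<Union>T. L x)"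
    by (intro SUP_cong refl same)
  then have ?number using L'(2) by simp
  moreover have ?spread
  proof
    fix P assume P: "P \<in> T"
    then have "(\<Inter>x\<in>P. L' x) = (\<Inter>x\<in>P. L x)" by (intro INF_cong refl same) blast
    then show "(\<Inter>x\<in>P. L x) = {}" using L'(3) P by simp
  qed
  ultimately show "?number \<and> ?spread" ..
next
  assume *: "?number \<and> ?spread"
  then have "finite (\<Union>x\<in>Q \<union> \<Union>T. L x)" by (intro card_ge_0_finite) simp
  then show "\<not> part_colourable Q T L"
    using card_colours_if_colourable[OF sys] * T(1) by fastforce
qed

section \<open>The graph for k at least 4\<close>

lemma K31_triple_system:
  assumes K: "is_K31 k V E \<P>"
  defines "T \<equiv> {P\<in>\<P>. card P = 3}"
  defines "Q \<equiv> \<Union>{P\<in>\<P>. card P = 1}"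
  shows "triple_system Q T" "Q \<union> \<Union>T = V"
    and "card T = k div 2 + 1" "card Q = k div 2 - 1"
    and "list_colourable V E L \<longleftrightarrow> part_colourable Q T L"
proof -
  have finV: "finite V" and part: "partition_on V \<P>"
    and E: "\<And>u v. E u v \<longleftrightarrow> u \<in> V \<and> v \<in> V \<and> \<not> (\<exists>P\<in>\<P>. u \<in> P \<and> v \<in> P)"
    and mset: "image_mset card (mset_set \<P>) =
       replicate_mset (k div 2 + 1) 3 + replicate_mset (k div 2 - 1) 1"
    using K by (auto simp: is_K31_def complete_multipartite_def)
  have fin\<P>: "finite \<P>" using finite_elements[OF finV part] .
  have disj: "disjoint \<P>" and V: "\<Union>\<P> = V" using part by (auto simp: partition_on_def)
  have count: "card {P\<in>\<P>. card P = n} = count (image_mset card (mset_set \<P>)) n" for n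
  proof -
    have "card -` {n} \<inter> \<P> = {P\<in>\<P>. card P = n}" by auto
    then show ?thesis using fin\<P> by (simp add: count_image_mset)
  qed
  show "card T = k div 2 + 1" using count[of 3] mset by (simp add: T_def)
  have singles: "card {P\<in>\<P>. card P = 1} = k div 2 - 1" using count[of 1] mset by simp
  have "card Q = sum card {P\<in>\<P>. card P = 1}"
    unfolding Q_def using disj
    by (intro card_Union_disjoint) (auto simp: pairwise_def disjnt_def disjoint_def intro: card_ge_0_finite)
  then show "card Q = k div 2 - 1" using singles by simp
  have sizes: "card P = 3 \<or> card P = 1" if "P \<in> \<P>" for P
  proof -
    have "card P \<in># image_mset card (mset_set \<P>)" using that fin\<P> by simp
    then show ?thesis unfolding mset by (auto split: if_splits)
  qed
  show QT: "Q \<union> \<Union>T = V" using V sizes unfolding Q_def T_def by blast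
  have same: "P = P'" if "P \<in> \<P>" "P' \<in> \<P>" "x \<in> P" "x \<in> P'" for P P' x
    using disj that unfolding disjoint_def by blast
  have "Q \<inter> \<Union>T = {}"
  proof (rule ccontr)
    assume "Q \<inter> \<Union>T \<noteq> {}"
    then obtain x P P' where "x \<in> P" "x \<in> P'" "P \<in> \<P>" "P' \<in> \<P>" "card P = 1" "card P' = 3"
      unfolding Q_def T_def by blast
    then show False using same[of P P' x] by auto
  qed
  moreover have "finite Q" using finV QT finite_subset by blast
  moreover have "disjoint T" using disj by (auto simp: disjoint_def T_def)
  ultimately show "triple_system Q T"
    using fin\<P> by (simp add: triple_system_def T_def)
  have adjacent: "E u v \<longleftrightarrow> u \<noteq> v \<and> \<not> (\<exists>P\<in>T. u \<in> P \<and> v \<in> P)" if uv: "u \<in> V" "v \<in> V" for u v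
  proof
    assume "E u v"
    then have "\<not> (\<exists>P\<in>\<P>. u \<in> P \<and> v \<in> P)" using E by blast
    then show "u \<noteq> v \<and> \<not> (\<exists>P\<in>T. u \<in> P \<and> v \<in> P)" using uv V unfolding T_def by blast
  next
    assume *: "u \<noteq> v \<and> \<not> (\<exists>P\<in>T. u \<in> P \<and> v \<in> P)"
    have "\<not> (u \<in> P \<and> v \<in> P)" if P: "P \<in> \<P>" for P
    proof
      assume "u \<in> P \<and> v \<in> P"
      moreover from this have "card P = 1" using * sizes[OF P] P unfolding T_def by blast
      ultimately show False using * by (auto simp: card_1_singleton_iff)
    qed
    then show "E u v" using E uv by blast
  qed
  show "list_colourable V E L \<longleftrightarrow> part_colourable Q T L"
    unfolding list_colourable_def list_colouring_def proper_colouring_def part_colourable_def QT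
    using adjacent by (intro ex_cong1) blast
qed

lemma K31_bad_iff:
  assumes "even k" and "k \<ge> 4" and K: "is_K31 k V E \<P>" and L: "k_list_assignment k V L"
  shows "bad_list_assignment k V E L \<longleftrightarrow>
    card (\<Union>v\<in>V. L v) = 3 * (k div 2) \<and> (\<forall>P\<in>\<P>. card P = 3 \<longrightarrow> (\<Inter>v\<in>P. L v) = {})"
proof -
  define T where "T = {P\<in>\<P>. card P = 3}"
  define Q where "Q = \<Union>{P\<in>\<P>. card P = 1}"
  note facts = K31_triple_system[OF K, folded T_def Q_def]
  have k: "k = 2 * (k div 2)" using assms(1) by simp
  have T: "card T = card Q + 2" "3 \<le> card T" "card Q + card T = k" "card Q + 1 = k div 2"
    using facts(3,4) assms(2) k by linarith+
  have "\<forall>x\<in>Q \<union> \<Union>T. infinite (L x) \<or> card Q + card T \<le> card (L x)"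
    using L unfolding facts(2) T(3) k_list_assignment_def .
  from not_colourable_iff[OF facts(1) T(1,2) this]
  have "\<not> list_colourable V E L \<longleftrightarrow>
      card (\<Union>v\<in>V. L v) = 3 * (k div 2) \<and> (\<forall>P\<in>T. (\<Inter>v\<in>P. L v) = {})"
    unfolding facts(2) T(4) facts(5) .
  then show ?thesis using L by (auto simp: bad_list_assignment_def T_def)
qed

section \<open>Two triples\<close>

text \<open>Otherwise each vertex of \<open>P2\<close> could use a colour that \<open>f\<close> leaves free.\<close>

lemma blocked_list:
  assumes not_col: "\<not> part_colourable {} {P1, P2} L"
    and f: "\<forall>x\<in>P1. f x \<in> L x"
  shows "\<exists>y\<in>P2. L y \<subseteq> f ` P1"
proof (rule ccontr)
  assume "\<not> ?thesis"
  then have "\<forall>y\<in>P2. \<exists>c. c \<in> L y \<and> c \<notin> f ` P1" by blast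
  then obtain g where g: "\<forall>y\<in>P2. g y \<in> L y \<and> g y \<notin> f ` P1" using bchoice by meson
  define h where "h x = (if x \<in> P1 then f x else g x)" for x
  have "\<forall>x\<in>{} \<union> \<Union>{P1, P2}. h x \<in> L x" using f g by (auto simp: h_def)
  moreover have "\<forall>x\<in>{} \<union> \<Union>{P1, P2}. \<forall>y\<in>{} \<union> \<Union>{P1, P2}.
      h x = h y \<longrightarrow> x = y \<or> (\<exists>P\<in>{P1, P2}. x \<in> P \<and> y \<in> P)"
  proof (intro ballI impI)
    fix x y assume xy: "x \<in> {} \<union> \<Union>{P1, P2}" "y \<in> {} \<union> \<Union>{P1, P2}" "h x = h y"
    have differ: "g z \<noteq> f t" if "z \<in> P2" "t \<in> P1" for z t using g that by auto
    have in2: "z \<in> P2" if "z \<in> {} \<union> \<Union>{P1, P2}" "z \<notin> P1" for z using that by auto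
    show "x = y \<or> (\<exists>P\<in>{P1, P2}. x \<in> P \<and> y \<in> P)"
    proof (cases "x \<in> P1")
      case True
      then have "y \<in> P1" using xy(3) differ[OF in2[OF xy(2)]] unfolding h_def by metis
      then show ?thesis using True by simp
    next
      case False
      then have "y \<notin> P1" using xy(3) differ[OF in2[OF xy(1)]] unfolding h_def by metis
      then show ?thesis using in2 xy(1,2) False by simp
    qed
  qed
  ultimately have "part_colourable {} {P1, P2} L"
    unfolding part_colourable_def by (intro exI[of _ h] conjI)
  then show False using not_col by simp
qed

lemma K33_no_common:
  assumes not_col: "\<not> part_colourable {} {P1, P2} L"
    and two: "\<forall>y\<in>P2. \<exists>a\<in>L y. \<exists>b\<in>L y. a \<noteq> b"
  shows "\<not> (\<forall>x\<in>P1. c \<in> L x)"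
proof
  assume "\<forall>x\<in>P1. c \<in> L x"
  then obtain y where "y \<in> P2" "L y \<subseteq> (\<lambda>_. c) ` P1"
    using blocked_list[OF not_col, of "\<lambda>_. c"] by blast
  then show False using two by blast
qed

text \<open>Colour \<open>u\<close> and \<open>v\<close> by \<open>x\<close> and \<open>w\<close> by any colour \<open>z\<close> of its list. The blocked list of \<open>P2\<close> lies in
  \<open>{x, z}\<close>, hence equals it. Different \<open>z\<close> block different vertices, and there are only two
  values of \<open>z\<close> because otherwise \<open>x\<close> would be common to all lists of \<open>P2\<close>.\<close>

lemma K33_shared_colour:
  assumes not_col: "\<not> part_colourable {} {P1, P2} L"
    and two: "\<forall>y\<in>P1 \<union> P2. \<exists>a\<in>L y. \<exists>b\<in>L y. a \<noteq> b"
    and P1: "P1 = {u, v, w}" "u \<noteq> w" "v \<noteq> w" and P2: "card P2 = 3"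
    and x: "x \<in> L u" "x \<in> L v"
  obtains c d u2 v2 w2 where "c \<noteq> d" "c \<noteq> x" "d \<noteq> x" "L w = {c, d}"
    "P2 = {u2, v2, w2}" "distinct [u2, v2, w2]" "L u2 = {x, c}" "L v2 = {x, d}"
proof -
  have xw: "x \<notin> L w" using K33_no_common[OF not_col, of x] two P1(1) x by auto
  have ex: "\<exists>y\<in>P2. L y = {x, z}" if z: "z \<in> L w" for z
  proof -
    have "\<forall>y\<in>P1. ((\<lambda>_. x)(w := z)) y \<in> L y" using P1 x z by auto
    then obtain y where y: "y \<in> P2" "L y \<subseteq> ((\<lambda>_. x)(w := z)) ` P1"
      using blocked_list[OF not_col] by blast
    then have "L y \<subseteq> {x, z}" by (auto split: if_splits)
    moreover obtain a b where "a \<in> L y" "b \<in> L y" "a \<noteq> b" using two y(1) by blast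
    ultimately have "L y = {x, z}" by blast
    then show ?thesis using y(1) by blast
  qed
  have "\<exists>a\<in>L w. \<exists>b\<in>L w. a \<noteq> b" using two P1(1) by blast
  then obtain c d where cd: "c \<in> L w" "d \<in> L w" "c \<noteq> d" by blast
  obtain u2 where u2: "u2 \<in> P2" "L u2 = {x, c}" using ex[OF cd(1)] by blast
  obtain v2 where v2: "v2 \<in> P2" "L v2 = {x, d}" using ex[OF cd(2)] by blast
  have ne: "c \<noteq> x" "d \<noteq> x" using cd xw by auto
  then have "u2 \<noteq> v2" using u2 v2 cd(3) by auto
  have third: "P2 = {u2, v2, y}" if "y \<in> P2" "y \<noteq> u2" "y \<noteq> v2" for y
  proof -
    have "finite P2" using P2 by (intro card_ge_0_finite) simp
    moreover have "card {u2, v2, y} = card P2" using that \<open>u2 \<noteq> v2\<close> P2 by simp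
    moreover have "{u2, v2, y} \<subseteq> P2" using u2 v2 that by simp
    ultimately show ?thesis by (metis card_subset_eq)
  qed
  have Lw: "L w = {c, d}"
  proof (rule ccontr)
    assume "L w \<noteq> {c, d}"
    then obtain e where e: "e \<in> L w" "e \<noteq> c" "e \<noteq> d" using cd by blast
    then obtain y where y: "y \<in> P2" "L y = {x, e}" using ex by blast
    have "e \<noteq> x" using e xw by auto
    then have "y \<noteq> u2" "y \<noteq> v2" using y u2 v2 e ne by auto
    then have eqP2: "P2 = {u2, v2, y}" using third y(1) by blast
    have "\<not> part_colourable {} {P2, P1} L" using not_col by (simp add: insert_commute)
    from K33_no_common[OF this, of x] show False using two u2 v2 y unfolding eqP2 by simp
  qed
  have "card (P2 - {u2, v2}) = 1" using P2 u2 v2 \<open>u2 \<noteq> v2\<close> by (simp add: card_Diff_subset)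
  then obtain w2 where "P2 - {u2, v2} = {w2}" by (auto simp: card_1_singleton_iff)
  then have "w2 \<in> P2" "w2 \<noteq> u2" "w2 \<noteq> v2" by blast+
  then show thesis using that[of c d u2 v2 w2] third cd(3) ne Lw u2 v2 \<open>u2 \<noteq> v2\<close> by auto
qed

text \<open>The non-colourable assignment of \<open>K\<^sub>3\<^sub>,\<^sub>3\<close> over any colour type, with \<open>x\<close> in the place of the
  colour 1 and the order of the two parts made explicit.\<close>

definition K33_pattern :: "('v \<Rightarrow> 'c set) \<Rightarrow> 'v set \<Rightarrow> 'v set \<Rightarrow> 'c \<Rightarrow> 'c \<Rightarrow> 'c \<Rightarrow> 'c \<Rightarrow> 'c \<Rightarrow> bool" where
  "K33_pattern L P1 P2 x a b c d \<longleftrightarrow> x \<notin> {a, b, c, d} \<and> a \<noteq> b \<and> c \<noteq> d \<and>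
     (\<exists>u1 v1 w1 u2 v2 w2. distinct [u1, v1, w1] \<and> distinct [u2, v2, w2] \<and>
        P1 = {u1, v1, w1} \<and> P2 = {u2, v2, w2} \<and>
        L u1 = {x, a} \<and> L v1 = {x, b} \<and> L w1 = {c, d} \<and>
        L u2 = {x, c} \<and> L v2 = {x, d} \<and> L w2 = {a, b})"

lemma K33_patternE:
  assumes "K33_pattern L P1 P2 x a b c d"
  obtains u1 v1 w1 u2 v2 w2 where "x \<noteq> a" "x \<noteq> b" "x \<noteq> c" "x \<noteq> d" "a \<noteq> b" "c \<noteq> d"
    "distinct [u1, v1, w1]" "distinct [u2, v2, w2]" "P1 = {u1, v1, w1}" "P2 = {u2, v2, w2}"
    "L u1 = {x, a}" "L v1 = {x, b}" "L w1 = {c, d}" "L u2 = {x, c}" "L v2 = {x, d}" "L w2 = {a, b}"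
proof -
  have "x \<noteq> a" "x \<noteq> b" "x \<noteq> c" "x \<noteq> d" "a \<noteq> b" "c \<noteq> d"
    using assms unfolding K33_pattern_def by simp_all
  moreover obtain u1 v1 w1 u2 v2 w2 where
    "distinct [u1, v1, w1]" "distinct [u2, v2, w2]" "P1 = {u1, v1, w1}" "P2 = {u2, v2, w2}"
    "L u1 = {x, a}" "L v1 = {x, b}" "L w1 = {c, d}" "L u2 = {x, c}" "L v2 = {x, d}" "L w2 = {a, b}"
    using assms unfolding K33_pattern_def by (elim conjE exE)
  ultimately show thesis by (rule that)
qed

lemma K33_patternI:
  assumes "x \<noteq> a" "x \<noteq> b" "x \<noteq> c" "x \<noteq> d" "a \<noteq> b" "c \<noteq> d"
    "distinct [u1, v1, w1]" "distinct [u2, v2, w2]" "P1 = {u1, v1, w1}" "P2 = {u2, v2, w2}"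
    "L u1 = {x, a}" "L v1 = {x, b}" "L w1 = {c, d}" "L u2 = {x, c}" "L v2 = {x, d}" "L w2 = {a, b}"
  shows "K33_pattern L P1 P2 x a b c d"
proof -
  have "distinct [u1, v1, w1] \<and> distinct [u2, v2, w2] \<and> P1 = {u1, v1, w1} \<and> P2 = {u2, v2, w2} \<and>
      L u1 = {x, a} \<and> L v1 = {x, b} \<and> L w1 = {c, d} \<and>
      L u2 = {x, c} \<and> L v2 = {x, d} \<and> L w2 = {a, b}"
    by (intro conjI assms)
  then have "\<exists>u1 v1 w1 u2 v2 w2. distinct [u1, v1, w1] \<and> distinct [u2, v2, w2] \<and>
      P1 = {u1, v1, w1} \<and> P2 = {u2, v2, w2} \<and>
      L u1 = {x, a} \<and> L v1 = {x, b} \<and> L w1 = {c, d} \<and>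
      L u2 = {x, c} \<and> L v2 = {x, d} \<and> L w2 = {a, b}"
    by (intro exI)
  then show ?thesis unfolding K33_pattern_def using assms(1-6) by simp
qed

lemma K33_pattern_swap:
  assumes "K33_pattern L P1 P2 x a b c d"
  shows "K33_pattern L P2 P1 x c d a b"
proof -
  from assms obtain u1 v1 w1 u2 v2 w2 where
    "x \<noteq> a" "x \<noteq> b" "x \<noteq> c" "x \<noteq> d" "a \<noteq> b" "c \<noteq> d"
    "distinct [u1, v1, w1]" "distinct [u2, v2, w2]" "P1 = {u1, v1, w1}" "P2 = {u2, v2, w2}"
    "L u1 = {x, a}" "L v1 = {x, b}" "L w1 = {c, d}" "L u2 = {x, c}" "L v2 = {x, d}" "L w2 = {a, b}"
    by (rule K33_patternE)
  then show ?thesis by (intro K33_patternI[of x c d a b u2 v2 w2 u1 v1 w1])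
qed

lemma K33_pattern_swap_ab:
  assumes "K33_pattern L P1 P2 x a b c d"
  shows "K33_pattern L P1 P2 x b a c d"
proof -
  from assms obtain u1 v1 w1 u2 v2 w2 where
    "x \<noteq> a" "x \<noteq> b" "x \<noteq> c" "x \<noteq> d" "a \<noteq> b" "c \<noteq> d"
    "distinct [u1, v1, w1]" "distinct [u2, v2, w2]" "P1 = {u1, v1, w1}" "P2 = {u2, v2, w2}"
    "L u1 = {x, a}" "L v1 = {x, b}" "L w1 = {c, d}" "L u2 = {x, c}" "L v2 = {x, d}" "L w2 = {a, b}"
    by (rule K33_patternE)
  then show ?thesis by (intro K33_patternI[of x b a c d v1 u1 w1 u2 v2 w2]) auto
qed

text \<open>The shared colour \<open>x\<close> of \<open>P1\<close> forces two lists of \<open>P2\<close> to contain \<open>x\<close>, so that the same argument applies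
  with the parts exchanged.\<close>

lemma K33_pattern_if_shared:
  assumes not_col: "\<not> part_colourable {} {P1, P2} L"
    and two: "\<forall>y\<in>P1 \<union> P2. \<exists>a\<in>L y. \<exists>b\<in>L y. a \<noteq> b"
    and P1: "card P1 = 3" and P2: "card P2 = 3"
    and x: "u \<in> P1" "v \<in> P1" "u \<noteq> v" "x \<in> L u" "x \<in> L v"
  shows "\<exists>a b c d. K33_pattern L P1 P2 x a b c d"
proof -
  have not_col': "\<not> part_colourable {} {P2, P1} L" using not_col by (simp add: insert_commute)
  have "card (P1 - {u, v}) = 1" using P1 x by (simp add: card_Diff_subset)
  then obtain w where "P1 - {u, v} = {w}" by (auto simp: card_1_singleton_iff)
  then have w: "P1 = {u, v, w}" "u \<noteq> w" "v \<noteq> w" using x by blast+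
  obtain c d u2 v2 w2 where 2: "c \<noteq> d" "c \<noteq> x" "d \<noteq> x" "L w = {c, d}"
    "P2 = {u2, v2, w2}" "distinct [u2, v2, w2]" "L u2 = {x, c}" "L v2 = {x, d}"
    by (rule K33_shared_colour[OF not_col two w P2 x(4,5)])
  have two': "\<forall>y\<in>P2 \<union> P1. \<exists>a\<in>L y. \<exists>b\<in>L y. a \<noteq> b" using two by blast
  have x2: "u2 \<noteq> w2" "v2 \<noteq> w2" "x \<in> L u2" "x \<in> L v2" using 2 by auto
  obtain a b u1 v1 w1 where 1: "a \<noteq> b" "a \<noteq> x" "b \<noteq> x" "L w2 = {a, b}"
    "P1 = {u1, v1, w1}" "distinct [u1, v1, w1]" "L u1 = {x, a}" "L v1 = {x, b}"
    by (rule K33_shared_colour[OF not_col' two' 2(5) x2(1,2) P1 x2(3,4)])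
  have "x \<notin> L w" using 2 by auto
  then have "w \<noteq> u1" "w \<noteq> v1" using 1(7,8) by auto
  then have "w1 = w" using w(1) 1(5) by blast
  then have Lw1: "L w1 = {c, d}" using 2(4) by simp
  have "K33_pattern L P1 P2 x a b c d"
    by (rule K33_patternI[OF _ _ _ _ 1(1) 2(1) 1(6) 2(6) 1(5) 2(5) 1(7,8) Lw1 2(7,8) 1(4)])
      (use 1(2,3) 2(2,3) in auto)
  then show ?thesis by blast
qed

text \<open>If no two lists within a part met, no merging would be necessary: the empty set of merged triples
  already gives distinct representatives for all six vertices.\<close>

lemma K33_pattern_if_not_colourable:
  assumes sys: "triple_system {} {P1, P2}" and ne: "P1 \<noteq> P2"
    and lists: "\<forall>x\<in>P1 \<union> P2. infinite (L x) \<or> 2 \<le> card (L x)"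
    and not_col: "\<not> part_colourable {} {P1, P2} L"
  shows "\<exists>x a b c d. K33_pattern L P1 P2 x a b c d"
proof -
  have card: "card P1 = 3" "card P2 = 3" using sys by (auto simp: triple_system_def)
  have not_col': "\<not> part_colourable {} {P2, P1} L" using not_col by (simp add: insert_commute)
  have two: "\<exists>a\<in>L y. \<exists>b\<in>L y. a \<noteq> b" if "y \<in> P1 \<union> P2" for y
  proof -
    have "infinite (L y) \<or> 2 \<le> card (L y)" using lists that by blast
    then obtain A where "A \<subseteq> L y" "card A = 2"
      by (meson infinite_arbitrarily_large obtain_subset_with_card_n)
    then show ?thesis by (auto simp: card_2_iff)
  qed
  have "\<exists>P\<in>{P1, P2}. \<exists>u\<in>P. \<exists>v\<in>P. u \<noteq> v \<and> L u \<inter> L v \<noteq> {}"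
  proof (rule ccontr)
    assume "\<not> ?thesis"
    then have disj: "L u \<inter> L v = {}" if "P \<in> {P1, P2}" "u \<in> P" "v \<in> P" "u \<noteq> v" for P u v
      using that by blast
    obtain L' where L': "\<forall>x\<in>P1 \<union> P2. L' x \<subseteq> L x \<and> finite (L' x) \<and> 2 \<le> card (L' x) \<and> L x \<inter> {} \<subseteq> L' x"
      using obtain_finite_lists[OF finite.emptyI lists] .
    have disj': "L' u \<inter> L' v = {}" if P: "P \<in> {P1, P2}" "u \<in> P" "v \<in> P" "u \<noteq> v" for P u v
    proof -
      have "L' u \<subseteq> L u" "L' v \<subseteq> L v" using L' P by auto
      then show ?thesis using disj[OF P] by blast
    qed
    have pair: "\<exists>u\<in>P - {x}. \<exists>v\<in>P - {x}. u \<noteq> v" if "P \<in> {P1, P2}" for P x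
    proof -
      have "2 \<le> card (P - {x})" using that card by (auto simp: card_Diff_singleton_if)
      then obtain A where "A \<subseteq> P - {x}" "card A = 2" by (meson obtain_subset_with_card_n)
      then show ?thesis by (auto simp: card_2_iff)
    qed
    have none: "(\<Inter>y\<in>P - {x}. L' y) = {}" if P: "P \<in> {P1, P2}" for P x
    proof -
      obtain u v where "u \<in> P - {x}" "v \<in> P - {x}" "u \<noteq> v" using pair[OF P] by blast
      moreover from this have "L' u \<inter> L' v = {}" using disj'[OF P, of u v] by simp
      ultimately show ?thesis by blast
    qed
    interpret spread_lists "{}" "{P1, P2}" L'
    proof
      show "triple_system {} {P1, P2}" by (rule sys)
      show "finite (L' x) \<and> card {} + card {P1, P2} \<le> card (L' x)" if "x \<in> {} \<union> \<Union>{P1, P2}" for x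
        using L' that ne by (auto simp: numeral_2_eq_2)
      show "(\<Inter>x\<in>P. L' x) = {}" if P: "P \<in> {P1, P2}" for P
        using none[OF P] by blast
    qed
    have "\<forall>P\<in>{P1, P2} - {}. \<forall>x\<in>P. card (shared P x) \<le> 0"
      using none by (simp add: shared_def)
    then have "part_colourable {} {P1, P2} L'"
      by (intro colourable_merging[of "{}" _ 0]) auto
    then have "part_colourable {} {P1, P2} L"
      by (rule part_colourable_mono) (use L' in auto)
    then show False using not_col by blast
  qed
  then obtain P where P: "P \<in> {P1, P2}" and "\<exists>u\<in>P. \<exists>v\<in>P. u \<noteq> v \<and> L u \<inter> L v \<noteq> {}" ..
  then obtain u v where uv: "u \<in> P" "v \<in> P" "u \<noteq> v" "L u \<inter> L v \<noteq> {}" by auto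
  then obtain x where x: "x \<in> L u" "x \<in> L v" by auto
  have two12: "\<forall>y\<in>P1 \<union> P2. \<exists>a\<in>L y. \<exists>b\<in>L y. a \<noteq> b"
    and two21: "\<forall>y\<in>P2 \<union> P1. \<exists>a\<in>L y. \<exists>b\<in>L y. a \<noteq> b"
    by (auto intro!: two)
  show ?thesis
  proof (cases "P = P1")
    case True
    then have "\<exists>a b c d. K33_pattern L P1 P2 x a b c d"
      using K33_pattern_if_shared[OF not_col two12 card _ _ uv(3) x] uv(1,2) by simp
    then show ?thesis by (rule exI)
  next
    case False
    then have "P = P2" using P by simp
    then have "\<exists>a b c d. K33_pattern L P2 P1 x a b c d"
      using K33_pattern_if_shared[OF not_col' two21 card(2,1) _ _ uv(3) x] uv(1,2) by simp
    then obtain a b c d where "K33_pattern L P2 P1 x a b c d" by (elim exE)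
    then have "K33_pattern L P1 P2 x c d a b" by (rule K33_pattern_swap)
    then show ?thesis by (intro exI)
  qed
qed

section \<open>Isomorphisms between pattern assignments\<close>

text \<open>Renaming the vertices moves coincidences between \<open>{a, b}\<close> and \<open>{c, d}\<close> to fixed positions, so
  that equally many coincidences become the same coincidences.\<close>

lemma K33_pattern_normal:
  assumes "K33_pattern L P1 P2 x a b c d"
  obtains a' b' c' d' where "K33_pattern L P1 P2 x a' b' c' d'"
    "{a', b'} = {a, b}" "{c', d'} = {c, d}"
    "a' = c' \<and> b' = d' \<or> a' = c' \<and> b' \<noteq> d' \<or> {a', b'} \<inter> {c', d'} = {}"
proof -
  have swap_cd: "K33_pattern L P1 P2 x p q s r" if "K33_pattern L P1 P2 x p q r s" for p q r s
    using K33_pattern_swap[OF K33_pattern_swap_ab[OF K33_pattern_swap[OF that]]] .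
  note ab = K33_pattern_swap_ab[OF assms] and cd = swap_cd[OF assms]
  note abcd = swap_cd[OF ab]
  consider "a = c" | "a = d" | "b = c" | "b = d" | "{a, b} \<inter> {c, d} = {}" by blast
  then show thesis
  proof cases
    case 1
    then show thesis using that[of a b c d] assms by simp
  next
    case 2
    then show thesis using that[of a b d c] cd by (simp add: insert_commute)
  next
    case 3
    then show thesis using that[of b a c d] ab by (simp add: insert_commute)
  next
    case 4
    then show thesis using that[of b a d c] abcd by (simp add: insert_commute)
  next
    case 5
    then show thesis using that[of a b c d] assms by simp
  qed
qed

lemma K33_pattern_colours:
  assumes "K33_pattern L P1 P2 x a b c d"
  shows "(\<Union>v\<in>P1 \<union> P2. L v) = {x, a, b, c, d}"
  using assms by (rule K33_patternE) auto

text \<open>The number of coincidences is thus an isomorphism invariant.\<close>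

lemma K33_pattern_card:
  assumes "K33_pattern L P1 P2 x a b c d"
  shows "card (\<Union>v\<in>P1 \<union> P2. L v) + card ({a, b} \<inter> {c, d}) = 5"
proof -
  have ne: "x \<notin> {a, b} \<union> {c, d}" "a \<noteq> b" "c \<noteq> d"
    using assms unfolding K33_pattern_def by auto
  have "card ({a, b} \<union> {c, d}) + card ({a, b} \<inter> {c, d}) = 4"
    using card_Un_Int[of "{a, b}" "{c, d}"] ne by simp
  moreover have U: "(\<Union>v\<in>P1 \<union> P2. L v) = insert x ({a, b} \<union> {c, d})"
    unfolding K33_pattern_colours[OF assms] by auto
  moreover have "card (insert x ({a, b} \<union> {c, d})) = Suc (card ({a, b} \<union> {c, d}))"
    by (rule card_insert_disjoint[OF _ ne(1)]) simp
  ultimately show ?thesis unfolding U by linarith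
qed

text \<open>If \<open>x\<close> is used in one part, the two lists of the other part containing \<open>x\<close> must use the two
  colours of the third list of the first part. If \<open>x\<close> is not used at all, \<open>a\<close> and \<open>b\<close> are
  both used in the first part and block \<open>{a, b}\<close>.\<close>

lemma K33_pattern_not_colourable:
  assumes "K33_pattern L P1 P2 x a b c d" and disj: "P1 \<inter> P2 = {}"
  shows "\<not> part_colourable {} {P1, P2} L"
proof
  assume "part_colourable {} {P1, P2} L"
  then obtain f where f: "\<forall>v\<in>P1 \<union> P2. f v \<in> L v"
    and sep: "\<forall>u\<in>P1 \<union> P2. \<forall>v\<in>P1 \<union> P2. f u = f v \<longrightarrow> u = v \<or> (\<exists>P\<in>{P1, P2}. u \<in> P \<and> v \<in> P)"
    unfolding part_colourable_def by auto
  have ne: "f u \<noteq> f v" if "u \<in> P1" "v \<in> P2" for u v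
  proof
    assume "f u = f v"
    then have "u = v \<or> (\<exists>P\<in>{P1, P2}. u \<in> P \<and> v \<in> P)" using sep that by (meson UnI1 UnI2)
    then show False using disj that by auto
  qed
  from assms(1) show False
  proof (rule K33_patternE)
    fix u1 v1 w1 u2 v2 w2
    assume P: "P1 = {u1, v1, w1}" "P2 = {u2, v2, w2}"
      and L: "L u1 = {x, a}" "L v1 = {x, b}" "L w1 = {c, d}" "L u2 = {x, c}" "L v2 = {x, d}" "L w2 = {a, b}"
    have val: "f u1 = x \<or> f u1 = a" "f v1 = x \<or> f v1 = b" "f w1 = c \<or> f w1 = d"
      "f u2 = x \<or> f u2 = c" "f v2 = x \<or> f v2 = d" "f w2 = a \<or> f w2 = b"
      using f L unfolding P by auto
    have "f u \<noteq> f v" if "u \<in> {u1, v1, w1}" "v \<in> {u2, v2, w2}" for u v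
      using ne that P by simp
    then have "f u1 \<noteq> f u2" "f u1 \<noteq> f v2" "f u1 \<noteq> f w2" "f v1 \<noteq> f u2" "f v1 \<noteq> f v2" "f v1 \<noteq> f w2"
      "f w1 \<noteq> f u2" "f w1 \<noteq> f v2" by simp_all
    then show False using val by metis
  qed
qed

lemma K33_pattern_exists:
  assumes "card P1 = 3" "card P2 = 3" "P1 \<inter> P2 = {}"
    and "x \<notin> {a, b, c, d}" "a \<noteq> b" "c \<noteq> d"
  shows "\<exists>L. K33_pattern L P1 P2 x a b c d"
proof -
  obtain u1 v1 w1 u2 v2 w2 where P: "P1 = {u1, v1, w1}" "P2 = {u2, v2, w2}"
    and ne: "u1 \<noteq> v1" "v1 \<noteq> w1" "u1 \<noteq> w1" "u2 \<noteq> v2" "v2 \<noteq> w2" "u2 \<noteq> w2"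
    using assms(1,2) unfolding card_3_iff by (elim exE conjE)
  have dist: "u1 \<noteq> u2" "u1 \<noteq> v2" "u1 \<noteq> w2" "v1 \<noteq> u2" "v1 \<noteq> v2" "v1 \<noteq> w2" "w1 \<noteq> u2" "w1 \<noteq> v2" "w1 \<noteq> w2"
    using assms(3) unfolding P by auto
  define L where "L = (\<lambda>_. {x})(u1 := {x, a}, v1 := {x, b}, w1 := {c, d}, u2 := {x, c}, v2 := {x, d}, w2 := {a, b})"
  have "K33_pattern L P1 P2 x a b c d"
    by (rule K33_patternI[of x a b c d u1 v1 w1 u2 v2 w2])
      (use assms(4-6) P ne dist in \<open>simp_all add: L_def\<close>)
  then show ?thesis by blast
qed

lemma K33_pattern_isomorphic:
  assumes G: "complete_multipartite V E \<P>"
    and parts: "\<P> = {P1, P2}" "P1 \<inter> P2 = {}" and parts': "\<P> = {P1', P2'}" "P1' \<inter> P2' = {}"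
    and L: "K33_pattern L P1 P2 x a b c d" and L': "K33_pattern L' P1' P2' (\<pi> x) (\<pi> a) (\<pi> b) (\<pi> c) (\<pi> d)"
    and inj: "inj_on \<pi> {x, a, b, c, d}"
  shows "list_isomorphic V E L L'"
proof -
  have V: "\<Union>\<P> = V" and E: "\<And>u v. E u v \<longleftrightarrow> u \<in> V \<and> v \<in> V \<and> \<not> (\<exists>P\<in>\<P>. u \<in> P \<and> v \<in> P)"
    using G by (auto simp: complete_multipartite_def partition_on_def)
  from L obtain u1 v1 w1 u2 v2 w2 where P: "P1 = {u1, v1, w1}" "P2 = {u2, v2, w2}"
    and ne: "distinct [u1, v1, w1]" "distinct [u2, v2, w2]"
    and Lv: "L u1 = {x, a}" "L v1 = {x, b}" "L w1 = {c, d}" "L u2 = {x, c}" "L v2 = {x, d}" "L w2 = {a, b}"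
    by (rule K33_patternE)
  from L' obtain u1' v1' w1' u2' v2' w2' where P': "P1' = {u1', v1', w1'}" "P2' = {u2', v2', w2'}"
    and ne': "distinct [u1', v1', w1']" "distinct [u2', v2', w2']"
    and Lv': "L' u1' = {\<pi> x, \<pi> a}" "L' v1' = {\<pi> x, \<pi> b}" "L' w1' = {\<pi> c, \<pi> d}"
      "L' u2' = {\<pi> x, \<pi> c}" "L' v2' = {\<pi> x, \<pi> d}" "L' w2' = {\<pi> a, \<pi> b}"
    by (rule K33_patternE)
  have dist: "u1 \<noteq> u2" "u1 \<noteq> v2" "u1 \<noteq> w2" "v1 \<noteq> u2" "v1 \<noteq> v2" "v1 \<noteq> w2" "w1 \<noteq> u2" "w1 \<noteq> v2" "w1 \<noteq> w2"
    using parts(2) unfolding P by auto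
  have dist': "u1' \<noteq> u2'" "u1' \<noteq> v2'" "u1' \<noteq> w2'" "v1' \<noteq> u2'" "v1' \<noteq> v2'" "v1' \<noteq> w2'"
    "w1' \<noteq> u2'" "w1' \<noteq> v2'" "w1' \<noteq> w2'"
    using parts'(2) unfolding P' by auto
  have Vu: "V = P1 \<union> P2" "V = P1' \<union> P2'" using V parts(1) parts'(1) by auto
  define \<phi> where "\<phi> = (\<lambda>_. u1')(v1 := v1', w1 := w1', u2 := u2', v2 := v2', w2 := w2')"
  have \<phi>: "\<phi> u1 = u1'" "\<phi> v1 = v1'" "\<phi> w1 = w1'" "\<phi> u2 = u2'" "\<phi> v2 = v2'" "\<phi> w2 = w2'"
    using ne dist by (simp_all add: \<phi>_def)
  have image: "\<phi> ` P1 = P1'" "\<phi> ` P2 = P2'" unfolding P P' by (simp_all add: \<phi>)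
  have "inj_on \<phi> V"
    unfolding Vu(1) P by (rule inj_onI) (use \<phi> ne' dist' in auto)
  moreover have "\<phi> ` V = V" using image by (metis Vu image_Un)
  ultimately have bij: "bij_betw \<phi> V V" by (simp add: bij_betw_def)
  have same: "\<phi> v \<in> P1' \<longleftrightarrow> v \<in> P1" "\<phi> v \<in> P2' \<longleftrightarrow> v \<in> P2" if v: "v \<in> V" for v
  proof -
    have "v \<in> P1 \<and> v \<notin> P2 \<or> v \<in> P2 \<and> v \<notin> P1" using v Vu(1) parts(2) by auto
    moreover have "v \<in> P1 \<Longrightarrow> \<phi> v \<in> P1'" "v \<in> P2 \<Longrightarrow> \<phi> v \<in> P2'" using image by auto
    moreover have "\<not> (\<phi> v \<in> P1' \<and> \<phi> v \<in> P2')" using parts'(2) by auto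
    ultimately show "\<phi> v \<in> P1' \<longleftrightarrow> v \<in> P1" "\<phi> v \<in> P2' \<longleftrightarrow> v \<in> P2" by metis+
  qed
  have edge: "E u v \<longleftrightarrow> \<not> (u \<in> P1 \<and> v \<in> P1) \<and> \<not> (u \<in> P2 \<and> v \<in> P2)"
    "E u v \<longleftrightarrow> \<not> (u \<in> P1' \<and> v \<in> P1') \<and> \<not> (u \<in> P2' \<and> v \<in> P2')" if "u \<in> V" "v \<in> V" for u v
  proof -
    have *: "E u v \<longleftrightarrow> \<not> (\<exists>P\<in>\<P>. u \<in> P \<and> v \<in> P)" using E that by simp
    show "E u v \<longleftrightarrow> \<not> (u \<in> P1 \<and> v \<in> P1) \<and> \<not> (u \<in> P2 \<and> v \<in> P2)"
      using * unfolding parts(1) by simp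
    show "E u v \<longleftrightarrow> \<not> (u \<in> P1' \<and> v \<in> P1') \<and> \<not> (u \<in> P2' \<and> v \<in> P2')"
      using * unfolding parts'(1) by simp
  qed
  have "E (\<phi> u) (\<phi> v) \<longleftrightarrow> E u v" if "u \<in> V" "v \<in> V" for u v
    using edge(1)[OF that] edge(2)[of "\<phi> u" "\<phi> v"] same that bij_betwE[OF bij] by simp
  then have auto: "graph_automorphism V E \<phi>" using bij by (simp add: graph_automorphism_def)
  have lists: "L' (\<phi> v) = \<pi> ` L v" if "v \<in> V" for v
    using that unfolding Vu(1) P by (auto simp: \<phi> Lv Lv')
  have "(\<Union>v\<in>V. L' v) = (\<Union>v\<in>\<phi> ` V. L' v)" using \<open>\<phi> ` V = V\<close> by simp
  also have "\<dots> = (\<Union>v\<in>V. L' (\<phi> v))" by blast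
  also have "\<dots> = (\<Union>v\<in>V. \<pi> ` L v)" using lists by (intro SUP_cong) auto
  finally have "(\<Union>v\<in>V. L' v) = \<pi> ` (\<Union>v\<in>V. L v)" by (simp add: image_UN)
  moreover have "inj_on \<pi> (\<Union>v\<in>V. L v)"
    using inj unfolding Vu(1) K33_pattern_colours[OF L] .
  ultimately have "bij_betw \<pi> (\<Union>v\<in>V. L v) (\<Union>v\<in>V. L' v)" by (simp add: bij_betw_def)
  then show ?thesis unfolding list_isomorphic_def using auto lists by blast
qed

lemma list_isomorphic_colourable:
  assumes "list_isomorphic V E L L'" "list_colourable V E L"
  shows "list_colourable V E L'"
proof -
  obtain \<phi> \<pi> where \<phi>: "graph_automorphism V E \<phi>"
    and \<pi>: "bij_betw \<pi> (\<Union>v\<in>V. L v) (\<Union>v\<in>V. L' v)" and L': "\<forall>v\<in>V. L' (\<phi> v) = \<pi> ` L v"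
    using assms(1) unfolding list_isomorphic_def by blast
  obtain f where f: "\<forall>u\<in>V. \<forall>v\<in>V. E u v \<longrightarrow> f u \<noteq> f v" "\<forall>v\<in>V. f v \<in> L v"
    using assms(2) unfolding list_colourable_def list_colouring_def proper_colouring_def by blast
  have bij: "bij_betw \<phi> V V" and E: "\<forall>u\<in>V. \<forall>v\<in>V. E (\<phi> u) (\<phi> v) \<longleftrightarrow> E u v"
    using \<phi> by (auto simp: graph_automorphism_def)
  define \<psi> where "\<psi> = inv_into V \<phi>"
  have \<psi>: "\<psi> v \<in> V" "\<phi> (\<psi> v) = v" if "v \<in> V" for v
    using bij that unfolding \<psi>_def bij_betw_def by (metis inv_into_into, metis f_inv_into_f)
  have inU: "f v \<in> (\<Union>v\<in>V. L v)" if "v \<in> V" for v using f(2) that by blast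
  have "\<pi> (f (\<psi> u)) \<noteq> \<pi> (f (\<psi> v))" if uv: "u \<in> V" "v \<in> V" "E u v" for u v
  proof -
    have "E (\<psi> u) (\<psi> v)" using E \<psi> uv by metis
    then have "f (\<psi> u) \<noteq> f (\<psi> v)" using f(1) \<psi> uv by blast
    then show ?thesis using \<pi> inU \<psi>(1) uv unfolding bij_betw_def inj_on_def by metis
  qed
  moreover have "\<pi> (f (\<psi> v)) \<in> L' v" if "v \<in> V" for v
  proof -
    have "L' v = \<pi> ` L (\<psi> v)" using L' \<psi> that by metis
    then show ?thesis using f(2) \<psi>(1) that by simp
  qed
  ultimately show ?thesis
    unfolding list_colourable_def list_colouring_def proper_colouring_def
    by (intro exI[of _ "\<lambda>v. \<pi> (f (\<psi> v))"]) blast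
qed

lemma K33_form_iff_pattern:
  "K33_form \<P> L a b c d \<longleftrightarrow>
     (\<exists>P1 P2. \<P> = {P1, P2} \<and> P1 \<inter> P2 = {} \<and> K33_pattern L P1 P2 1 a b c d)"
proof
  assume "K33_form \<P> L a b c d"
  then obtain u1 v1 w1 u2 v2 w2 where
    "1 \<noteq> a" "1 \<noteq> b" "1 \<noteq> c" "1 \<noteq> d" "a \<noteq> b" "c \<noteq> d" "distinct [u1, v1, w1, u2, v2, w2]"
    "\<P> = {{u1, v1, w1}, {u2, v2, w2}}"
    "L u1 = {1, a}" "L v1 = {1, b}" "L w1 = {c, d}" "L u2 = {1, c}" "L v2 = {1, d}" "L w2 = {a, b}"
    unfolding K33_form_def by metis
  moreover from this have "K33_pattern L {u1, v1, w1} {u2, v2, w2} 1 a b c d"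
    by (intro K33_patternI) simp_all
  moreover from calculation have "{u1, v1, w1} \<inter> {u2, v2, w2} = {}" by auto
  ultimately show "\<exists>P1 P2. \<P> = {P1, P2} \<and> P1 \<inter> P2 = {} \<and> K33_pattern L P1 P2 1 a b c d" by metis
next
  assume "\<exists>P1 P2. \<P> = {P1, P2} \<and> P1 \<inter> P2 = {} \<and> K33_pattern L P1 P2 1 a b c d"
  then obtain P1 P2 where P: "\<P> = {P1, P2}" "P1 \<inter> P2 = {}" "K33_pattern L P1 P2 1 a b c d" by blast
  from P(3) show "K33_form \<P> L a b c d"
  proof (rule K33_patternE)
    fix u1 v1 w1 u2 v2 w2
    assume ne: "1 \<noteq> a" "1 \<noteq> b" "1 \<noteq> c" "1 \<noteq> d" "a \<noteq> b" "c \<noteq> d"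
      and P12: "distinct [u1, v1, w1]" "distinct [u2, v2, w2]" "P1 = {u1, v1, w1}" "P2 = {u2, v2, w2}"
      and L: "L u1 = {1, a}" "L v1 = {1, b}" "L w1 = {c, d}" "L u2 = {1, c}" "L v2 = {1, d}" "L w2 = {a, b}"
    have "distinct [u1, v1, w1, u2, v2, w2]" using P(2) P12 by auto
    moreover have "\<P> = {{u1, v1, w1}, {u2, v2, w2}}" using P(1) P12(3,4) by simp
    ultimately have "distinct [u1, v1, w1, u2, v2, w2] \<and> \<P> = {{u1, v1, w1}, {u2, v2, w2}} \<and>
        L u1 = {1, a} \<and> L v1 = {1, b} \<and> L w1 = {c, d} \<and>
        L u2 = {1, c} \<and> L v2 = {1, d} \<and> L w2 = {a, b}"
      by (intro conjI L)
    then have "\<exists>u1 v1 w1 u2 v2 w2. distinct [u1, v1, w1, u2, v2, w2] \<and>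
        \<P> = {{u1, v1, w1}, {u2, v2, w2}} \<and>
        L u1 = {1, a} \<and> L v1 = {1, b} \<and> L w1 = {c, d} \<and>
        L u2 = {1, c} \<and> L v2 = {1, d} \<and> L w2 = {a, b}"
      by (intro exI)
    then show ?thesis unfolding K33_form_def using ne by simp
  qed
qed

section \<open>The characterization\<close>

lemma K33_parts:
  assumes K: "is_K31 2 V E \<P>"
  obtains P1 P2 where "\<P> = {P1, P2}" "P1 \<noteq> P2"
proof -
  define T where "T = {P\<in>\<P>. card P = 3}"
  define Q where "Q = \<Union>{P\<in>\<P>. card P = 1}"
  note facts = K31_triple_system[OF K, folded T_def Q_def]
  have part: "partition_on V \<P>" using K by (simp add: is_K31_def complete_multipartite_def)
  have "finite Q" using facts(1) by (simp add: triple_system_def)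
  then have "V = \<Union>T" using facts(2,4) by simp
  have "\<P> = T"
  proof
    show "\<P> \<subseteq> T"
    proof
      fix P assume P: "P \<in> \<P>"
      then have "P \<noteq> {}" "P \<subseteq> V" using part by (auto simp: partition_on_def)
      then obtain x P' where "x \<in> P" "x \<in> P'" "P' \<in> T" using \<open>V = \<Union>T\<close> by blast
      moreover from this have "P' \<in> \<P>" by (simp add: T_def)
      moreover have "disjoint \<P>" using part by (simp add: partition_on_def)
      ultimately have "P = P'" using disjointD[of \<P> P P'] P by auto
      then show "P \<in> T" using \<open>P' \<in> T\<close> by simp
    qed
  qed (auto simp: T_def)
  moreover have "card T = 2" using facts(3) by simp
  ultimately show thesis using that by (auto simp: card_2_iff)
qed

lemma K33_facts:
  assumes K: "is_K31 2 V E {P1, P2}" and ne: "P1 \<noteq> P2"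
  shows "triple_system {} {P1, P2}" "V = P1 \<union> P2" "P1 \<inter> P2 = {}" "card P1 = 3" "card P2 = 3"
    and "list_colourable V E L \<longleftrightarrow> part_colourable {} {P1, P2} L"
proof -
  define T where "T = {P\<in>{P1, P2}. card P = 3}"
  define Q where "Q = \<Union>{P\<in>{P1, P2}. card P = 1}"
  note facts = K31_triple_system[OF K, folded T_def Q_def]
  have "card T = card {P1, P2}" using facts(3) ne by simp
  moreover have "T \<subseteq> {P1, P2}" by (auto simp: T_def)
  ultimately have T: "T = {P1, P2}" by (intro card_subset_eq) auto
  have "finite Q" using facts(1) by (simp add: triple_system_def)
  then have Q: "Q = {}" using facts(4) by simp
  show sys: "triple_system {} {P1, P2}" using facts(1) unfolding T Q .
  show "V = P1 \<union> P2" using facts(2) unfolding T Q by simp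
  show "card P1 = 3" "card P2 = 3" using sys by (simp_all add: triple_system_def)
  show "P1 \<inter> P2 = {}" using sys ne by (simp add: triple_system_def disjoint_def)
  show "list_colourable V E L \<longleftrightarrow> part_colourable {} {P1, P2} L"
    using facts(5) unfolding T Q .
qed

lemma K33_form_not_colourable:
  assumes K: "is_K31 2 V E \<P>" and form: "K33_form \<P> L a b c d"
  shows "\<not> list_colourable V E L"
proof -
  obtain P1 P2 where P: "\<P> = {P1, P2}" "P1 \<inter> P2 = {}" "K33_pattern L P1 P2 1 a b c d"
    using form unfolding K33_form_iff_pattern by (elim exE conjE)
  have "P1 \<noteq> P2" using P(2,3) unfolding K33_pattern_def by auto
  then have "list_colourable V E L \<longleftrightarrow> part_colourable {} {P1, P2} L"
    using K33_facts(6)[of V E P1 P2 L] K unfolding P(1) by simp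
  then show ?thesis using K33_pattern_not_colourable[OF P(3,2)] by simp
qed

lemma K33_pattern_rename:
  assumes "K33_pattern L P1 P2 x a b c d" and inj: "inj_on \<pi> {x, a, b, c, d}"
  shows "K33_pattern (\<lambda>v. \<pi> ` L v) P1 P2 (\<pi> x) (\<pi> a) (\<pi> b) (\<pi> c) (\<pi> d)"
proof -
  from assms(1) obtain u1 v1 w1 u2 v2 w2 where
    "x \<noteq> a" "x \<noteq> b" "x \<noteq> c" "x \<noteq> d" "a \<noteq> b" "c \<noteq> d"
    "distinct [u1, v1, w1]" "distinct [u2, v2, w2]" "P1 = {u1, v1, w1}" "P2 = {u2, v2, w2}"
    "L u1 = {x, a}" "L v1 = {x, b}" "L w1 = {c, d}" "L u2 = {x, c}" "L v2 = {x, d}" "L w2 = {a, b}"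
    by (rule K33_patternE)
  then show ?thesis
    by (intro K33_patternI[of _ _ _ _ _ u1 v1 w1 u2 v2 w2]) (simp_all add: inj_on_eq_iff[OF inj])
qed

lemma K33_bad_iff:
  fixes L :: "'v \<Rightarrow> 'c set"
  assumes K: "is_K31 2 V E \<P>" and L: "k_list_assignment 2 V L"
  shows "bad_list_assignment 2 V E L \<longleftrightarrow>
    (\<exists>L' a b c d. K33_form \<P> L' a b c d \<and> list_isomorphic V E L L')"
proof
  assume bad: "bad_list_assignment 2 V E L"
  obtain P1 P2 where P: "\<P> = {P1, P2}" "P1 \<noteq> P2" using K33_parts[OF K] .
  note facts = K33_facts[OF K[unfolded P(1)] P(2)]
  have "\<not> part_colourable {} {P1, P2} L"
    using bad facts(6)[of L] by (simp add: bad_list_assignment_def)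
  moreover have "\<forall>v\<in>P1 \<union> P2. infinite (L v) \<or> 2 \<le> card (L v)"
    using L facts(2) by (simp add: k_list_assignment_def)
  ultimately have "\<exists>x a b c d. K33_pattern L P1 P2 x a b c d"
    using K33_pattern_if_not_colourable[OF facts(1) P(2)] by simp
  then obtain x a b c d where pat: "K33_pattern L P1 P2 x a b c d" by (elim exE)
  obtain h :: "'c \<Rightarrow> nat" where h: "inj_on h {x, a, b, c, d}"
    using finite_imp_inj_to_nat_seg[of "{x, a, b, c, d}"] by auto
  \<comment> \<open>The shift by 2 keeps the value 1 for \<open>x\<close> alone.\<close>
  define \<pi> where "\<pi> y = (if y = x then 1 else h y + 2)" for y
  have inj: "inj_on \<pi> {x, a, b, c, d}" using h by (auto simp: inj_on_def \<pi>_def)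
  have "\<pi> x = 1" by (simp add: \<pi>_def)
  have pat': "K33_pattern (\<lambda>v. \<pi> ` L v) P1 P2 (\<pi> x) (\<pi> a) (\<pi> b) (\<pi> c) (\<pi> d)"
    by (rule K33_pattern_rename[OF pat inj])
  then have "K33_form \<P> (\<lambda>v. \<pi> ` L v) (\<pi> a) (\<pi> b) (\<pi> c) (\<pi> d)"
    unfolding K33_form_iff_pattern \<open>\<pi> x = 1\<close> using P(1) facts(3) by blast
  moreover have "complete_multipartite V E \<P>" using K by (simp add: is_K31_def)
  then have "list_isomorphic V E L (\<lambda>v. \<pi> ` L v)"
    using K33_pattern_isomorphic P(1) facts(3) pat pat' inj by metis
  ultimately show "\<exists>L' a b c d. K33_form \<P> L' a b c d \<and> list_isomorphic V E L L'" by blast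
next
  assume "\<exists>L' a b c d. K33_form \<P> L' a b c d \<and> list_isomorphic V E L L'"
  then have "\<not> list_colourable V E L"
    using K33_form_not_colourable[OF K] list_isomorphic_colourable by metis
  then show "bad_list_assignment 2 V E L" using L by (simp add: bad_list_assignment_def)
qed

lemma overlap_cases:
  assumes "a \<noteq> b" "c \<noteq> d"
    and "a = c \<and> b = d \<or> a = c \<and> b \<noteq> d \<or> {a, b} \<inter> {c, d} = {}"
  shows "card ({a, b} \<inter> {c, d}) = (if a = c then if b = d then 2 else 1 else 0)"
  using assms by (auto simp: Int_insert_left split: if_splits)

text \<open>After normalization the renaming of colours is forced by the names, and it is well defined and
  injective because the coincidences agree.\<close>

lemma K33_form_isomorphic_iff:
  assumes K: "is_K31 2 V E \<P>" and form: "K33_form \<P> L a b c d" and form': "K33_form \<P> L' a' b' c' d'"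
  shows "list_isomorphic V E L L' \<longleftrightarrow> card ({a, b} \<inter> {c, d}) = card ({a', b'} \<inter> {c', d'})"
proof
  have V: "V = \<Union>\<P>"
    using K by (auto simp: is_K31_def complete_multipartite_def partition_on_def)
  obtain P1 P2 where P: "\<P> = {P1, P2}" "P1 \<inter> P2 = {}" and pat: "K33_pattern L P1 P2 1 a b c d"
    using form unfolding K33_form_iff_pattern by (elim exE conjE)
  obtain P1' P2' where P': "\<P> = {P1', P2'}" "P1' \<inter> P2' = {}" and pat': "K33_pattern L' P1' P2' 1 a' b' c' d'"
    using form' unfolding K33_form_iff_pattern by (elim exE conjE)
  have V1: "V = P1 \<union> P2" using V unfolding P(1) by simp
  have V2: "V = P1' \<union> P2'" using V unfolding P'(1) by simp
  have "card (\<Union>v\<in>V. L v) + card ({a, b} \<inter> {c, d}) = 5"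
    using K33_pattern_card[OF pat] unfolding V1 .
  moreover have "card (\<Union>v\<in>V. L' v) + card ({a', b'} \<inter> {c', d'}) = 5"
    using K33_pattern_card[OF pat'] unfolding V2 .
  moreover assume "list_isomorphic V E L L'"
  then have "card (\<Union>v\<in>V. L v) = card (\<Union>v\<in>V. L' v)"
    unfolding list_isomorphic_def by (elim exE conjE) (rule bij_betw_same_card)
  ultimately show "card ({a, b} \<inter> {c, d}) = card ({a', b'} \<inter> {c', d'})" by linarith
next
  have G: "complete_multipartite V E \<P>" using K by (simp add: is_K31_def)
  obtain P1 P2 where P: "\<P> = {P1, P2}" "P1 \<inter> P2 = {}" and pat: "K33_pattern L P1 P2 1 a b c d"
    using form unfolding K33_form_iff_pattern by (elim exE conjE)
  obtain P1' P2' where P': "\<P> = {P1', P2'}" "P1' \<inter> P2' = {}" and pat': "K33_pattern L' P1' P2' 1 a' b' c' d'"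
    using form' unfolding K33_form_iff_pattern by (elim exE conjE)
  obtain p q r s where n: "K33_pattern L P1 P2 1 p q r s" "{p, q} = {a, b}" "{r, s} = {c, d}"
    "p = r \<and> q = s \<or> p = r \<and> q \<noteq> s \<or> {p, q} \<inter> {r, s} = {}"
    using K33_pattern_normal[OF pat] .
  obtain p' q' r' s' where n': "K33_pattern L' P1' P2' 1 p' q' r' s'" "{p', q'} = {a', b'}" "{r', s'} = {c', d'}"
    "p' = r' \<and> q' = s' \<or> p' = r' \<and> q' \<noteq> s' \<or> {p', q'} \<inter> {r', s'} = {}"
    using K33_pattern_normal[OF pat'] .
  assume "card ({a, b} \<inter> {c, d}) = card ({a', b'} \<inter> {c', d'})"
  then have card_eq: "card ({p, q} \<inter> {r, s}) = card ({p', q'} \<inter> {r', s'})"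
    unfolding n(2,3) n'(2,3) .
  have ne: "1 \<notin> {p, q, r, s}" "p \<noteq> q" "r \<noteq> s" using n(1) unfolding K33_pattern_def by simp_all
  have ne': "1 \<notin> {p', q', r', s'}" "p' \<noteq> q'" "r' \<noteq> s'" using n'(1) unfolding K33_pattern_def by simp_all
  have "(if p = r then if q = s then 2 else 1 else 0) =
      (if p' = r' then if q' = s' then 2 else 1 else 0::nat)"
    using card_eq overlap_cases[OF ne(2,3) n(4)] overlap_cases[OF ne'(2,3) n'(4)] by simp
  then have pr: "p' = r' \<longleftrightarrow> p = r" and qs0: "p = r \<and> q = s \<longleftrightarrow> p' = r' \<and> q' = s'"
    by (auto split: if_splits)
  \<comment> \<open>In normal form only \<open>p = r\<close> and \<open>q = s\<close> can coincide, the latter only together with the former.\<close>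
  have disj: "p \<noteq> s" "r \<noteq> q" "q = s \<longrightarrow> p = r" using n(4) ne by auto
  have disj': "p' \<noteq> s'" "r' \<noteq> q'" "q' = s' \<longrightarrow> p' = r'" using n'(4) ne' by auto
  have qs: "q' = s' \<longleftrightarrow> q = s" using qs0 disj(3) disj'(3) by blast
  have ones: "1 \<noteq> p" "1 \<noteq> q" "1 \<noteq> r" "1 \<noteq> s" "1 \<noteq> p'" "1 \<noteq> q'" "1 \<noteq> r'" "1 \<noteq> s'"
    using ne(1) ne'(1) by simp_all
  define \<pi> where "\<pi> = (\<lambda>_. 1::nat)(p := p', q := q', r := r', s := s')"
  have \<pi>: "\<pi> 1 = 1" "\<pi> p = p'" "\<pi> q = q'" "\<pi> r = r'" "\<pi> s = s'"
    using ones ne(2,3) disj(1,2) pr qs unfolding \<pi>_def fun_upd_def by metis+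
  have "inj_on \<pi> {1, p, q, r, s}"
  proof (rule inj_onI)
    fix y z assume "y \<in> {1, p, q, r, s}" "z \<in> {1, p, q, r, s}" "\<pi> y = \<pi> z"
    then show "y = z"
      using \<pi> ones pr qs ne'(2,3) disj'(1,2) by (elim insertE emptyE) metis+
  qed
  then show "list_isomorphic V E L L'"
    using K33_pattern_isomorphic[OF G P P' n(1), of L' \<pi>] n'(1) unfolding \<pi> by simp
qed

lemma K33_form_overlaps:
  assumes K: "is_K31 2 V E \<P>"
  shows "(\<exists>L a b c d. K33_form \<P> L a b c d \<and> card ({a, b} \<inter> {c, d}) = m) \<longleftrightarrow> m \<in> {0, 1, 2}"
proof
  assume "\<exists>L a b c d. K33_form \<P> L a b c d \<and> card ({a, b} \<inter> {c, d}) = m"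
  then obtain a b c d :: nat where m: "card ({a, b} \<inter> {c, d}) = m" by blast
  have "card ({a, b} \<inter> {c, d}) \<le> card {a, b}" by (intro card_mono) auto
  also have "\<dots> \<le> 2" by (simp add: card_insert_if)
  finally show "m \<in> {0, 1, 2}" unfolding m by auto
next
  assume m: "m \<in> {0, 1, 2}"
  obtain P1 P2 where P: "\<P> = {P1, P2}" "P1 \<noteq> P2" using K33_parts[OF K] .
  note facts = K33_facts[OF K[unfolded P(1)] P(2)]
  have form: "\<exists>L. K33_form \<P> L a b c d"
    if new: "1 \<notin> {a, b, c, d}" "a \<noteq> b" "c \<noteq> d" for a b c d
  proof -
    obtain L where "K33_pattern L P1 P2 1 a b c d"
      using K33_pattern_exists[OF facts(4,5,3) new] by (elim exE)
    then have "K33_form \<P> L a b c d" unfolding K33_form_iff_pattern using P(1) facts(3) by blast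
    then show ?thesis by blast
  qed
  have "\<exists>L. K33_form \<P> L 2 3 4 5" "\<exists>L. K33_form \<P> L 2 3 2 4" "\<exists>L. K33_form \<P> L 2 3 2 3"
    by (intro form; simp)+
  moreover have "card ({2, 3} \<inter> {4, 5::nat}) = 0" "card ({2, 3} \<inter> {2, 4::nat}) = 1"
    "card ({2, 3} \<inter> {2, 3::nat}) = 2"
    by simp_all
  ultimately show "\<exists>L a b c d. K33_form \<P> L a b c d \<and> card ({a, b} \<inter> {c, d}) = m"
    using m by blast
qed

theorem mainTheorem1:
  fixes k :: nat and V :: "'v set" and E :: "'v \<Rightarrow> 'v \<Rightarrow> bool" and \<P> :: "'v set set"
  assumes "even k" and "k \<ge> 2" and "is_K31 k V E \<P>"
  shows
    "(k \<ge> 4 \<longrightarrow>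
        (\<forall>L :: 'v \<Rightarrow> 'c set. k_list_assignment k V L \<longrightarrow>
           (bad_list_assignment k V E L \<longleftrightarrow>
              card (\<Union>v\<in>V. L v) = 3 * (k div 2) \<and>
              (\<forall>P\<in>\<P>. card P = 3 \<longrightarrow> (\<Inter>v\<in>P. L v) = {})))) \<and>
     (k = 2 \<longrightarrow>
        (\<forall>L :: 'v \<Rightarrow> 'c set. k_list_assignment 2 V L \<longrightarrow>
           (bad_list_assignment 2 V E L \<longleftrightarrow>
              (\<exists>L' a b c d. K33_form \<P> L' a b c d \<and> list_isomorphic V E L L'))) \<and>
        (\<forall>L a b c d L' a' b' c' d'. K33_form \<P> L a b c d \<longrightarrow> K33_form \<P> L' a' b' c' d' \<longrightarrow>
           (list_isomorphic V E L L' \<longleftrightarrow>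
              card ({a, b} \<inter> {c, d}) = card ({a', b'} \<inter> {c', d'}))) \<and>
        (\<forall>m. (\<exists>L a b c d. K33_form \<P> L a b c d \<and> card ({a, b} \<inter> {c, d}) = m)
             \<longleftrightarrow> m \<in> {0, 1, 2}))"
proof (intro conjI impI allI)
  fix L :: "'v \<Rightarrow> 'c set"
  assume "4 \<le> k" "k_list_assignment k V L"
  then show "bad_list_assignment k V E L \<longleftrightarrow>
      card (\<Union>v\<in>V. L v) = 3 * (k div 2) \<and> (\<forall>P\<in>\<P>. card P = 3 \<longrightarrow> (\<Inter>v\<in>P. L v) = {})"
    by (rule K31_bad_iff[OF assms(1) _ assms(3)])
next
  fix L :: "'v \<Rightarrow> 'c set"
  assume "k = 2" "k_list_assignment 2 V L"
  then show "bad_list_assignment 2 V E L \<longleftrightarrow>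
      (\<exists>L' a b c d. K33_form \<P> L' a b c d \<and> list_isomorphic V E L L')"
    using assms(3) by (intro K33_bad_iff) simp_all
next
  fix L a b c d L' a' b' c' d'
  assume "k = 2" "K33_form \<P> L a b c d" "K33_form \<P> L' a' b' c' d'"
  then show "list_isomorphic V E L L' \<longleftrightarrow> card ({a, b} \<inter> {c, d}) = card ({a', b'} \<inter> {c', d'})"
    using assms(3) by (intro K33_form_isomorphic_iff) simp_all
next
  fix m
  assume "k = 2"
  then show "(\<exists>L a b c d. K33_form \<P> L a b c d \<and> card ({a, b} \<inter> {c, d}) = m) \<longleftrightarrow> m \<in> {0, 1, 2}"
    using assms(3) by (intro K33_form_overlaps) simp
qed

end
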